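(* Let $\mathcal{J}$ be a Euclidean Jordan algebra of rank $r$ with cone of squares $\mathcal{K}$. Let $\epsilon>0$, $\delta,\beta\in(0,1)$, let $A=\{a_1,\dots,a_m\}\in\mathcal{J}^m$, $b\in\mathbb{R}^m$, and $\rho=\max_{i\in[m]}\|a_i\|_\infty$. Then the multiplicative weights algorithm described in the context (with an exponential-mechanism dual oracle) is $(\epsilon,\delta)$-low sensitivity scalar private with sensitivity $\Delta_\infty$, and, provided there is $x\in\mathcal{K}$ with $\mathrm{Tr}(x)=1$ and $\langle a_i,x\rangle\le b_i$ for all $i\in[m]$, with probability at least $1-\beta$ it outputs $x^*\in\mathcal{K}$ such that $\langle a_i,x^*\rangle\le b_i+\alpha$ for all $i\in[m]$, where $$\alpha=\widetilde O\!\left(\frac{\rho^{1/2}\Delta_\infty^{1/2}}{\epsilon^{1/2}}\log^{1/4}r\,\log^{1/4}(1/\delta)\,\log^{1/2}(1/\beta)\,\log^{1/2}m\right).$$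
   Context: A Euclidean Jordan algebra (EJA) is a finite-dimensional real vector space $\mathcal{J}$ with a commutative bilinear product $\circ$ satisfying $x^2\circ(x\circ y)=x\circ(x^2\circ y)$ (where $x^2=x\circ x$), an identity element $e$, and an inner product with $\langle x\circ y,z\rangle=\langle x,y\circ z\rangle$. A Jordan frame is a set $\{q_1,\dots,q_r\}$ of primitive idempotents with $q_i\circ q_j=0$ for $i\ne j$ and $\sum_i q_i=e$. Every $x\in\mathcal{J}$ has a spectral decomposition $x=\sum_{i=1}^r\lambda_i(x)q_i$ for some Jordan frame; $r$ is the rank of $\mathcal{J}$. $\mathrm{Tr}(x)=\sum_i\lambda_i(x)$, $\exp(x)=\sum_ie^{\lambda_i(x)}q_i$, $\langle x,y\rangle=\mathrm{Tr}(x\circ y)$, $\|x\|_\infty=\max_i|\lambda_i(x)|$. The cone of squares is $\mathcal{K}=\{x\circ x:x\in\mathcal{J}\}$. $\widetilde O(f)$ means $O(f\,\mathrm{poly}\log f)$. Low sensitivity scalar privacy: the constraints $A$ are public, and $b,b'\in\mathbb{R}^m$ are neighboring if $\|b-b'\|_\infty\le\Delta_\infty$ (vector $\ell_\infty$ norm). A mechanism $\mathcal{M}$ with outputs in $\mathcal{J}$ is $(\epsilon,\delta)$-low sensitivity scalar private if $\Pr[\mathcal{M}(b,A)\in S]\le e^\epsilon\Pr[\mathcal{M}(b',A)\in S]+\delta$ for all neighboring $b,b'$ and all $S\subseteq\mathcal{J}$. Algorithm (accuracy parameter $\alpha$): put $\eta=\frac{\alpha}{4\rho}$, $T=\frac{16\rho^2\log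 r}{\alpha^2}$, $\epsilon'=\frac{\epsilon}{\sqrt{8T\log(1/\delta)}}$, $x^1=e/r$. For $t=1,\dots,T$: sample $p^t\in[m]$ by the $\epsilon'$-private exponential mechanism with quality score $Q(i,b)=\langle a_i,x^t\rangle-b_i$, i.e. with probability proportional to $\exp(\frac{\epsilon'}{2\Delta_\infty}Q(i,b))$; let $\ell^t=\frac1\rho a_{p^t}$; let $x^{t+1}=\exp(-\eta\sum_{i=1}^t\ell^i)/\mathrm{Tr}(\exp(-\eta\sum_{i=1}^t\ell^i))$. Output $\frac1T\sum_{t=1}^Tx^t$.
   Formalization: Privacy is proved under ε ≤ 48 log(1/δ), as it fails for ε large relative to log(1/δ); in the bound on α, log m and log(1/β) are replaced by max(1, log m) and max(1, log(1/β)), as the bound would vanish for m = 1 or β → 1; T is rounded up to a positive integer. *)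

theory Defs
  imports "HOL-Probability.Probability"
begin

section \<open>Euclidean Jordan algebras\<close>

text \<open>
  The algebra is carried by a finite-dimensional subspace of an arbitrary real inner product space
  rather than by a type of class \<^class>\<open>euclidean_space\<close>. In this way algebras of every dimension
  and rank can be quantified over inside a formula, so that the constants hidden in an asymptotic
  bound can be required to be independent of the algebra.
\<close>

record 'v jordan =
  jcarrier :: "'v set"
  jmult :: "'v \<Rightarrow> 'v \<Rightarrow> 'v"
  junit :: 'v

text \<open>
  The associative inner product required by the axioms is the one of the ambient space; the trace
  inner product used by the algorithm is \<open>trace_inner\<close> below, and the two need not coincide.
\<close>

locale euclidean_jordan_algebra =
  fixes \<J> :: "'v::real_inner jordan"
  assumes subspace_carrier: "subspace (jcarrier \<J>)"
    and finite_dim: "\<exists>B. finite B \<and> span B = jcarrier \<J>"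
    and mult_closed: "\<lbrakk>x \<in> jcarrier \<J>; y \<in> jcarrier \<J>\<rbrakk> \<Longrightarrow> jmult \<J> x y \<in> jcarrier \<J>"
    and mult_add: "\<lbrakk>x \<in> jcarrier \<J>; y \<in> jcarrier \<J>; z \<in> jcarrier \<J>\<rbrakk>
      \<Longrightarrow> jmult \<J> (x + y) z = jmult \<J> x z + jmult \<J> y z"
    and mult_scaleR: "\<lbrakk>x \<in> jcarrier \<J>; y \<in> jcarrier \<J>\<rbrakk>
      \<Longrightarrow> jmult \<J> (c *\<^sub>R x) y = c *\<^sub>R jmult \<J> x y"
    and mult_commute: "\<lbrakk>x \<in> jcarrier \<J>; y \<in> jcarrier \<J>\<rbrakk> \<Longrightarrow> jmult \<J> x y = jmult \<J> y x"
    and jordan_identity: "\<lbrakk>x \<in> jcarrier \<J>; y \<in> jcarrier \<J>\<rbrakk>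
      \<Longrightarrow> jmult \<J> (jmult \<J> x x) (jmult \<J> x y) = jmult \<J> x (jmult \<J> (jmult \<J> x x) y)"
    and unit_closed: "junit \<J> \<in> jcarrier \<J>"
    and unit_mult: "x \<in> jcarrier \<J> \<Longrightarrow> jmult \<J> (junit \<J>) x = x"
    and inner_assoc: "\<lbrakk>x \<in> jcarrier \<J>; y \<in> jcarrier \<J>; z \<in> jcarrier \<J>\<rbrakk>
      \<Longrightarrow> inner (jmult \<J> x y) z = inner x (jmult \<J> y z)"

definition idempotent :: "'v::real_inner jordan \<Rightarrow> 'v \<Rightarrow> bool" where
  "idempotent \<J> q \<longleftrightarrow> q \<in> jcarrier \<J> \<and> jmult \<J> q q = q"

definition primitive_idempotent :: "'v::real_inner jordan \<Rightarrow> 'v \<Rightarrow> bool" where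
  "primitive_idempotent \<J> q \<longleftrightarrow> idempotent \<J> q \<and> q \<noteq> 0 \<and>
     \<not> (\<exists>c d. idempotent \<J> c \<and> idempotent \<J> d \<and> c \<noteq> 0 \<and> d \<noteq> 0 \<and> q = c + d)"

definition jordan_frame :: "'v::real_inner jordan \<Rightarrow> 'v set \<Rightarrow> bool" where
  "jordan_frame \<J> F \<longleftrightarrow> finite F \<and> (\<forall>q\<in>F. primitive_idempotent \<J> q) \<and>
     (\<forall>q\<in>F. \<forall>q'\<in>F. q \<noteq> q' \<longrightarrow> jmult \<J> q q' = 0) \<and> \<Sum>F = junit \<J>"

definition spectral_decomposition ::
  "'v::real_inner jordan \<Rightarrow> 'v \<Rightarrow> 'v set \<Rightarrow> ('v \<Rightarrow> real) \<Rightarrow> bool" where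
  "spectral_decomposition \<J> x F l \<longleftrightarrow> jordan_frame \<J> F \<and> x = (\<Sum>q\<in>F. l q *\<^sub>R q)"

text \<open>
  Every element has a spectral decomposition, any two Jordan frames have the same cardinality, and
  the multiset of eigenvalues as well as \<open>jexp\<close> below do not depend on the decomposition; hence the
  arbitrary choices made here are harmless.
\<close>

definition jrank :: "'v::real_inner jordan \<Rightarrow> nat" where
  "jrank \<J> = card (SOME F. jordan_frame \<J> F)"

definition spectral_choice :: "'v::real_inner jordan \<Rightarrow> 'v \<Rightarrow> 'v set \<times> ('v \<Rightarrow> real)" where
  "spectral_choice \<J> x = (SOME (F, l). spectral_decomposition \<J> x F l)"

definition spectral_frame :: "'v::real_inner jordan \<Rightarrow> 'v \<Rightarrow> 'v set" where
  "spectral_frame \<J> x = fst (spectral_choice \<J> x)"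

definition eigenvalue :: "'v::real_inner jordan \<Rightarrow> 'v \<Rightarrow> 'v \<Rightarrow> real" where
  "eigenvalue \<J> x = snd (spectral_choice \<J> x)"

definition jtrace :: "'v::real_inner jordan \<Rightarrow> 'v \<Rightarrow> real" where
  "jtrace \<J> x = (\<Sum>q\<in>spectral_frame \<J> x. eigenvalue \<J> x q)"

definition jexp :: "'v::real_inner jordan \<Rightarrow> 'v \<Rightarrow> 'v" where
  "jexp \<J> x = (\<Sum>q\<in>spectral_frame \<J> x. exp (eigenvalue \<J> x q) *\<^sub>R q)"

definition spectral_norm :: "'v::real_inner jordan \<Rightarrow> 'v \<Rightarrow> real" where
  "spectral_norm \<J> x = Max ((\<lambda>q. \<bar>eigenvalue \<J> x q\<bar>) ` spectral_frame \<J> x)"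

definition trace_inner :: "'v::real_inner jordan \<Rightarrow> 'v \<Rightarrow> 'v \<Rightarrow> real" where
  "trace_inner \<J> x y = jtrace \<J> (jmult \<J> x y)"

definition cone_of_squares :: "'v::real_inner jordan \<Rightarrow> 'v set" where
  "cone_of_squares \<J> = {jmult \<J> x x | x. x \<in> jcarrier \<J>}"


section \<open>Low sensitivity scalar privacy\<close>

text \<open>
  Index sets \<open>[m]\<close> are \<open>{..<m}\<close>; a vector of \<open>\<real>\<^sup>m\<close> is a function on \<^typ>\<open>nat\<close> whose values outside
  \<open>{..<m}\<close> are never inspected.
\<close>

definition linf_norm :: "nat \<Rightarrow> (nat \<Rightarrow> real) \<Rightarrow> real" where
  "linf_norm m v = Max ((\<lambda>i. \<bar>v i\<bar>) ` {..<m})"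

definition neighboring :: "nat \<Rightarrow> real \<Rightarrow> (nat \<Rightarrow> real) \<Rightarrow> (nat \<Rightarrow> real) \<Rightarrow> bool" where
  "neighboring m \<Delta> b b' \<longleftrightarrow> linf_norm m (\<lambda>i. b i - b' i) \<le> \<Delta>"

text \<open>Mechanisms with finitely many outcomes suffice, so they are modelled by \<^type>\<open>pmf\<close>.\<close>

definition low_sens_scalar_private ::
  "'v set \<Rightarrow> nat \<Rightarrow> real \<Rightarrow> real \<Rightarrow> real \<Rightarrow> ((nat \<Rightarrow> real) \<Rightarrow> 'v pmf) \<Rightarrow> bool" where
  "low_sens_scalar_private X m \<Delta> \<epsilon> \<delta> M \<longleftrightarrow>
     (\<forall>b b'. neighboring m \<Delta> b b' \<longrightarrow>
        (\<forall>S\<subseteq>X. measure_pmf.prob (M b) S \<le> exp \<epsilon> * measure_pmf.prob (M b') S + \<delta>))"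

definition exp_mechanism :: "nat \<Rightarrow> real \<Rightarrow> real \<Rightarrow> (nat \<Rightarrow> real) \<Rightarrow> nat pmf" where
  "exp_mechanism m \<epsilon> \<Delta> Q = embed_pmf (\<lambda>i. if i < m
     then exp (\<epsilon> / (2 * \<Delta>) * Q i) / (\<Sum>j<m. exp (\<epsilon> / (2 * \<Delta>) * Q j)) else 0)"


section \<open>The multiplicative weights algorithm\<close>

definition width :: "'v::real_inner jordan \<Rightarrow> nat \<Rightarrow> (nat \<Rightarrow> 'v) \<Rightarrow> real" where
  "width \<J> m a = Max ((\<lambda>i. spectral_norm \<J> (a i)) ` {..<m})"

text \<open>
  The number of rounds has to be a positive integer, so \<open>16 \<rho>\<^sup>2 log r / \<alpha>\<^sup>2\<close> is rounded up, and
  up to 1 if it vanishes.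
\<close>

definition num_rounds :: "real \<Rightarrow> nat \<Rightarrow> real \<Rightarrow> nat" where
  "num_rounds \<rho> r \<alpha> = max 1 (nat \<lceil>16 * \<rho>\<^sup>2 * ln (real r) / \<alpha>\<^sup>2\<rceil>)"

text \<open>
  \<open>mw_iterate \<J> a \<rho> \<eta> [p\<^sup>1, \<dots>, p\<^sup>t]\<close> is the iterate \<open>x\<^sup>t\<^sup>+\<^sup>1\<close> determined by the first \<open>t\<close> answers of
  the dual oracle.
\<close>

definition mw_iterate ::
  "'v::real_inner jordan \<Rightarrow> (nat \<Rightarrow> 'v) \<Rightarrow> real \<Rightarrow> real \<Rightarrow> nat list \<Rightarrow> 'v" where
  "mw_iterate \<J> a \<rho> \<eta> ps =
     (if ps = [] then (1 / real (jrank \<J>)) *\<^sub>R junit \<J>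
      else let w = jexp \<J> (- (\<eta> *\<^sub>R (\<Sum>p\<leftarrow>ps. (1 / \<rho>) *\<^sub>R a p)))
           in (1 / jtrace \<J> w) *\<^sub>R w)"

primrec mw_transcript ::
  "'v::real_inner jordan \<Rightarrow> nat \<Rightarrow> (nat \<Rightarrow> 'v) \<Rightarrow> real \<Rightarrow> real \<Rightarrow> real \<Rightarrow> real \<Rightarrow> (nat \<Rightarrow> real)
     \<Rightarrow> nat \<Rightarrow> nat list pmf" where
  "mw_transcript \<J> m a \<rho> \<eta> \<epsilon>' \<Delta> b 0 = return_pmf []"
| "mw_transcript \<J> m a \<rho> \<eta> \<epsilon>' \<Delta> b (Suc t) =
     bind_pmf (mw_transcript \<J> m a \<rho> \<eta> \<epsilon>' \<Delta> b t) (\<lambda>ps.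
       map_pmf (\<lambda>p. ps @ [p])
         (exp_mechanism m \<epsilon>' \<Delta> (\<lambda>i. trace_inner \<J> (a i) (mw_iterate \<J> a \<rho> \<eta> ps) - b i)))"

definition mw_mechanism ::
  "'v::real_inner jordan \<Rightarrow> nat \<Rightarrow> (nat \<Rightarrow> 'v) \<Rightarrow> real \<Rightarrow> real \<Rightarrow> real \<Rightarrow> real \<Rightarrow> (nat \<Rightarrow> real)
     \<Rightarrow> 'v pmf" where
  "mw_mechanism \<J> m a \<epsilon> \<delta> \<Delta> \<alpha> b =
     (let \<rho> = width \<J> m a;
          \<eta> = \<alpha> / (4 * \<rho>);
          T = num_rounds \<rho> (jrank \<J>) \<alpha>;
          \<epsilon>' = \<epsilon> / sqrt (8 * real T * ln (1 / \<delta>))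
      in map_pmf (\<lambda>ps. (1 / real T) *\<^sub>R (\<Sum>t<T. mw_iterate \<J> a \<rho> \<eta> (take t ps)))
           (mw_transcript \<J> m a \<rho> \<eta> \<epsilon>' \<Delta> b T))"


section \<open>The accuracy bound\<close>

text \<open>
  \<open>soft_O P f\<close> is the class of functions \<open>g\<close> with \<open>g = O(f poly log f)\<close> uniformly over the
  parameter set \<open>P\<close>; the poly-logarithmic factor is kept bounded below by 1.
\<close>

definition soft_O :: "'p set \<Rightarrow> ('p \<Rightarrow> real) \<Rightarrow> ('p \<Rightarrow> real) set" where
  "soft_O P f = {g. \<exists>C k. \<forall>p\<in>P. \<bar>g p\<bar> \<le> C * (\<bar>f p\<bar> * (1 + ln (1 + \<bar>f p\<bar>)) ^ k)}"

text \<open>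
  The per-round budget \<open>\<epsilon>' = \<epsilon> / sqrt (8 T log (1/\<delta>))\<close> composes to \<open>(\<epsilon>, \<delta>)\<close> over arbitrarily many
  rounds only if \<open>\<epsilon>\<close> is not too large compared with \<open>log (1/\<delta>)\<close>: the privacy loss has mean up to about
  \<open>T \<epsilon>'\<^sup>2 / 8 = \<epsilon>\<^sup>2 / (64 log (1/\<delta>))\<close>, and the Chernoff bound for its tail above \<open>\<epsilon>\<close> is at most \<open>\<delta>\<close>
  exactly when \<open>\<epsilon> \<le> 48 log (1/\<delta>)\<close>. This is the condition under which privacy is claimed in the main
  theorem.
\<close>

text \<open>Parameters are ordered as \<open>(r, m, \<rho>, \<Delta>, \<epsilon>, \<delta>, \<beta>)\<close>.\<close>

type_synonym mw_params = "nat \<times> nat \<times> real \<times> real \<times> real \<times> real \<times> real"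

definition mw_params :: "mw_params set" where
  "mw_params = {(r, m, \<rho>, \<Delta>, \<epsilon>, \<delta>, \<beta>). 1 \<le> r \<and> 1 \<le> m \<and> 0 \<le> \<rho> \<and> 0 < \<Delta> \<and> 0 < \<epsilon> \<and>
     0 < \<delta> \<and> \<delta> < 1 \<and> 0 < \<beta> \<and> \<beta> < 1}"

text \<open>
  As usual inside an asymptotic bound, the logarithms of \<open>m\<close> and \<open>1/\<beta>\<close> are bounded below by 1:
  with the plain logarithm the bound would vanish for \<open>m = 1\<close> and tend to 0 for \<open>\<beta> \<rightarrow> 1\<close>. On
  \<open>m \<ge> 2\<close>, \<open>\<beta> \<le> 1/2\<close> this only changes the hidden constant.
\<close>

definition log_ge1 :: "real \<Rightarrow> real" where
  "log_ge1 t = max 1 (ln t)"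

fun mw_accuracy_bound :: "mw_params \<Rightarrow> real" where
  "mw_accuracy_bound (r, m, \<rho>, \<Delta>, \<epsilon>, \<delta>, \<beta>) =
     \<rho> powr (1/2) * \<Delta> powr (1/2) / \<epsilon> powr (1/2)
       * ln (real r) powr (1/4) * ln (1 / \<delta>) powr (1/4)
       * log_ge1 (1 / \<beta>) powr (1/2) * log_ge1 (real m) powr (1/2)"

end

theory Submission
  imports Defs "HOL-Computational_Algebra.Fundamental_Theorem_Algebra"
begin

text \<open>
  Privacy: one round of the exponential mechanism has a privacy loss of range \<open>\<epsilon>'\<close>, so Hoeffding's
  lemma bounds its moment generating function, and these bounds multiply over adaptive rounds.

  Accuracy: the potential \<open>Tr (exp y)\<close> is controlled without the Golden--Thompson inequality. Expanding
  along the eigenframes of \<open>y\<close> and \<open>z\<close>, traces such as \<open>Tr (exp z \<circ> (z - y)\<^sup>2)\<close> become double sums with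
  the nonnegative weights \<open>Tr (q \<circ> p)\<close>, so a scalar Taylor bound yields a second-order expansion of
  \<open>Tr (exp z)\<close> around \<open>y\<close>. The loss of utility of the exponential mechanism is summed over all rounds
  before a tail bound is applied; a union bound over rounds would cost a factor \<open>log T\<close>, which is not
  polylogarithmic in the claimed bound.

  The trace is linear because nonorthogonal primitive idempotents have equal norms: hence
  \<open>\<Sum>\<^bsub>q\<in>F\<^esub> q / |q|\<^sup>2\<close> does not depend on the Jordan frame \<open>F\<close>, and it represents the trace.
\<close>

section \<open>Spectral theory of Euclidean Jordan algebras\<close>

text \<open>Trace, rank and exponential are defined through arbitrary choices, so the spectral
  theorem has to come out of the axioms. The ambient inner product supplies the positivity that
  excludes nonreal roots of a minimal polynomial. Since an algebra is a record with a carrier set,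
  the Peirce 1-space of an idempotent is again an instance of the locale, and existence results can
  be applied inside it.

  The number of rounds and \<open>\<epsilon>'\<close> depend on \<alpha>, which makes the selection
  error of the exponential mechanism proportional to 1/\<alpha>. The condition is therefore one on
  \<alpha>^2, which explains the square and fourth roots in the bound. With \<alpha> equal to 16
  times the bound, the average violation splits into \<alpha>/4 from the term log r, \<alpha>/2 from
  the second-order term and \<alpha>/4 from selection. This calculation needs rank at least 2 and
  \<alpha> < 2\<rho>. If \<alpha> \<ge> 2\<rho> every density is accurate enough, and in rank 1
  there is only one density.\<close>

lemma map_poly_of_real_arith:
  fixes p q :: "real poly"
  shows "map_poly complex_of_real (p + q) = map_poly of_real p + map_poly of_real q"
    and "map_poly complex_of_real (p * q) = map_poly of_real p * map_poly of_real q"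
    and "poly (map_poly complex_of_real p) (of_real x) = of_real (poly p x)"
proof -
  show add: "map_poly complex_of_real (p + q) = map_poly of_real p + map_poly of_real q" for p q
    by (rule poly_eqI) (simp add: coeff_map_poly)
  have smult: "map_poly complex_of_real (smult c p) = smult (of_real c) (map_poly of_real p)" for c p
    by (rule poly_eqI) (simp add: coeff_map_poly)
  show "map_poly complex_of_real (p * q) = map_poly of_real p * map_poly of_real q"
    by (induction p) (simp_all add: add smult map_poly_pCons mult_pCons_left)
  show "poly (map_poly complex_of_real p) (of_real x) = of_real (poly p x)"
    by (induction p) (simp_all add: map_poly_pCons)
qed

text \<open>Take a complex root a + bi. If b = 0 it gives a linear factor; otherwise the remainder
  modulo (X - a)^2 + b^2 has degree at most 1 and vanishes at a nonreal point, so it is 0.\<close>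

lemma real_poly_factor:
  fixes p :: "real poly"
  assumes "degree p > 0"
  obtains a g where "p = [:- a, 1:] * g" | a b g where "b \<noteq> 0" "p = [:a\<^sup>2 + b\<^sup>2, - 2 * a, 1:] * g"
proof -
  let ?c = "map_poly complex_of_real"
  have "degree (?c p) > 0" using assms by (simp add: degree_map_poly)
  then have "\<not> constant (poly (?c p))" by (simp add: constant_degree)
  then obtain z where z: "poly (?c p) z = 0" using fundamental_theorem_of_algebra by blast
  obtain a b where ab: "z = Complex a b" by (cases z)
  show ?thesis
  proof (cases "b = 0")
    case True
    then have "z = of_real a" using ab by (simp add: complex_eq_iff)
    then have "poly p a = 0" using z by (simp add: map_poly_of_real_arith)
    then show ?thesis using that(1) by (auto simp: poly_eq_0_iff_dvd)
  next
    case False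
    define Q where "Q = [:a\<^sup>2 + b\<^sup>2, - 2 * a, 1:]"
    have Q: "Q \<noteq> 0" "degree Q = 2" by (simp_all add: Q_def)
    have Qz: "poly (?c Q) z = 0"
      by (simp add: Q_def ab map_poly_pCons complex_eq_iff power2_eq_square algebra_simps)
    define R where "R = p mod Q"
    have "degree R < 2 \<or> R = 0"
      using degree_mod_less[OF Q(1), of p] Q(2) by (auto simp: R_def)
    then have "degree R \<le> 1" by auto
    then obtain u v where R: "R = [:u, v:]"
      using that degree1_coeffs by (metis One_nat_def degree_eq_zeroE le_Suc_eq le_zero_eq pCons_0_0)
    have "p = Q * (p div Q) + R" by (simp add: R_def)
    then have "poly (?c (Q * (p div Q) + R)) z = 0" using z by simp
    then have "poly (?c R) z = 0"
      using Qz by (simp add: map_poly_of_real_arith)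
    then have "v * b = 0" "u + v * a = 0"
      by (auto simp: R ab map_poly_pCons complex_eq_iff algebra_simps)
    then have "R = 0" using False R by simp
    then have "p = Q * (p div Q)" using \<open>p = Q * (p div Q) + R\<close> by simp
    then show ?thesis using that(2)[OF False, of a "p div Q"] by (simp add: Q_def)
  qed
qed

section \<open>Bilinear calculus, polarised Jordan identity and Peirce spaces\<close>

context euclidean_jordan_algebra
begin

abbreviation J where "J \<equiv> jcarrier \<J>"
abbreviation mul (infixl "\<odot>" 70) where "x \<odot> y \<equiv> jmult \<J> x y"
abbreviation \<e> where "\<e> \<equiv> junit \<J>"

lemma carrier_simps [simp]:
  "x \<in> J \<Longrightarrow> y \<in> J \<Longrightarrow> x \<odot> y \<in> J" "\<e> \<in> J" "0 \<in> J" "x \<in> J \<Longrightarrow> y \<in> J \<Longrightarrow> x + y \<in> J"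
  "x \<in> J \<Longrightarrow> y \<in> J \<Longrightarrow> x - y \<in> J" "x \<in> J \<Longrightarrow> c *\<^sub>R x \<in> J" "x \<in> J \<Longrightarrow> - x \<in> J"
  using mult_closed unit_closed subspace_carrier
  by (auto simp: subspace_0 subspace_add subspace_diff subspace_scale subspace_neg)

lemma sum_carrier [simp]: "(\<And>i. i \<in> A \<Longrightarrow> f i \<in> J) \<Longrightarrow> sum f A \<in> J"
  using subspace_carrier by (rule subspace_sum)

lemma mult_add_right: "x \<in> J \<Longrightarrow> y \<in> J \<Longrightarrow> z \<in> J \<Longrightarrow> x \<odot> (y + z) = x \<odot> y + x \<odot> z"
  using mult_add mult_commute by simp

lemma mult_scaleR_right: "x \<in> J \<Longrightarrow> y \<in> J \<Longrightarrow> x \<odot> (c *\<^sub>R y) = c *\<^sub>R (x \<odot> y)"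
  using mult_scaleR mult_commute by simp

lemma mult_minus_left: "x \<in> J \<Longrightarrow> y \<in> J \<Longrightarrow> (- x) \<odot> y = - (x \<odot> y)"
  using mult_scaleR[of x y "-1"] by simp

lemma mult_minus_right: "x \<in> J \<Longrightarrow> y \<in> J \<Longrightarrow> x \<odot> (- y) = - (x \<odot> y)"
  using mult_scaleR_right[of x y "-1"] by simp

lemma mult_diff_left: "x \<in> J \<Longrightarrow> y \<in> J \<Longrightarrow> z \<in> J \<Longrightarrow> (x - y) \<odot> z = x \<odot> z - y \<odot> z"
  using mult_add[of x "- y" z] by (simp add: mult_minus_left)

lemma mult_diff_right: "x \<in> J \<Longrightarrow> y \<in> J \<Longrightarrow> z \<in> J \<Longrightarrow> x \<odot> (y - z) = x \<odot> y - x \<odot> z"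
  using mult_add_right[of x y "- z"] by (simp add: mult_minus_right)

lemma mult_zero [simp]: "x \<in> J \<Longrightarrow> 0 \<odot> x = 0" "x \<in> J \<Longrightarrow> x \<odot> 0 = 0"
  using mult_scaleR[of 0 x 0] mult_scaleR_right[of x 0 0] by simp_all

lemma unit_mult_right [simp]: "x \<in> J \<Longrightarrow> x \<odot> \<e> = x"
  using unit_mult mult_commute by simp

lemma mult_sum_left: "(\<And>i. i \<in> A \<Longrightarrow> f i \<in> J) \<Longrightarrow> y \<in> J \<Longrightarrow> sum f A \<odot> y = (\<Sum>i\<in>A. f i \<odot> y)"
  by (induction A rule: infinite_finite_induct) (auto simp: mult_add)

lemma mult_sum_right: "(\<And>i. i \<in> A \<Longrightarrow> f i \<in> J) \<Longrightarrow> y \<in> J \<Longrightarrow> y \<odot> sum f A = (\<Sum>i\<in>A. y \<odot> f i)"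
  by (induction A rule: infinite_finite_induct) (auto simp: mult_add_right)

lemmas mult_distribs = mult_add mult_add_right mult_diff_left mult_diff_right mult_scaleR
  mult_scaleR_right mult_minus_left mult_minus_right

lemma inner_mult_left: "x \<in> J \<Longrightarrow> y \<in> J \<Longrightarrow> z \<in> J \<Longrightarrow> inner (x \<odot> y) z = inner y (x \<odot> z)"
  using inner_assoc mult_commute by metis

text \<open>The defect of the Jordan identity is cubic in \<open>x\<close>; \<open>A\<close> and
  \<open>B\<close> are its parts of bidegree (2,1) and (1,2) when \<open>x + y\<close> is inserted.
  The identity at \<open>x + y\<close> gives \<open>A + B = 0\<close>, the one at
  \<open>x - y\<close> gives \<open>A - B = 0\<close>.\<close>

lemma jordan_polarised:
  assumes "x \<in> J" "y \<in> J" "u \<in> J"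
  shows "(x \<odot> x) \<odot> (y \<odot> u) + 2 *\<^sub>R ((x \<odot> y) \<odot> (x \<odot> u)) = y \<odot> ((x \<odot> x) \<odot> u) + 2 *\<^sub>R (x \<odot> ((x \<odot> y) \<odot> u))"
proof -
  note [simp] = assms
  have yx: "y \<odot> x = x \<odot> y" by (rule mult_commute) auto
  define A where "A = (x \<odot> x) \<odot> (y \<odot> u) + 2 *\<^sub>R ((x \<odot> y) \<odot> (x \<odot> u)) - (y \<odot> ((x \<odot> x) \<odot> u) + 2 *\<^sub>R (x \<odot> ((x \<odot> y) \<odot> u)))"
  define B where "B = (y \<odot> y) \<odot> (x \<odot> u) + 2 *\<^sub>R ((x \<odot> y) \<odot> (y \<odot> u)) - (x \<odot> ((y \<odot> y) \<odot> u) + 2 *\<^sub>R (y \<odot> ((x \<odot> y) \<odot> u)))"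
  have "A + B = 0"
    using jordan_identity[of "x + y" u] jordan_identity[of x u] jordan_identity[of y u] 
    by (simp add: mult_distribs yx A_def B_def scaleR_2 algebra_simps)
  moreover have "A - B = 0"
    using jordan_identity[of "x - y" u] jordan_identity[of x u] jordan_identity[of y u] 
    by (simp add: mult_distribs yx A_def B_def scaleR_2 algebra_simps)
  ultimately have "2 *\<^sub>R A = 0"
    by (simp add: scaleR_2)
  then show ?thesis by (simp add: A_def)
qed

text \<open>Solves the polarised identity, with its last two arguments exchanged, for the operator
  of \<open>(x \<odot> x) \<odot> z\<close>. Both the recursion for powers and the Peirce equation
  of an idempotent are instances.\<close>

lemma mult_square_mult:
  assumes "x \<in> J" "z \<in> J" "u \<in> J"
  shows "((x \<odot> x) \<odot> z) \<odot> u = (x \<odot> x) \<odot> (z \<odot> u) + 2 *\<^sub>R ((x \<odot> z) \<odot> (x \<odot> u)) - 2 *\<^sub>R (x \<odot> (z \<odot> (x \<odot> u)))"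
  using jordan_polarised[OF assms(1,3,2)] mult_commute[of z u] mult_commute[of "x \<odot> z" "x \<odot> u"]
    mult_commute[of "(x \<odot> x) \<odot> z" u] mult_commute[of z "x \<odot> u"] assms
  by (simp add: algebra_simps)

lemma idempotent_simps:
  assumes "idempotent \<J> q" shows "q \<in> J" "q \<odot> q = q"
  using assms by (auto simp: idempotent_def)

text \<open>For \<open>q \<odot> x = x\<close> the polarised identity reads q(xu) + 2 x(qu) = x(qu)
  + 2 q(xu).\<close>

lemma idempotent_mult_commute:
  assumes q: "idempotent \<J> q" and x: "x \<in> J" "q \<odot> x = x" and u: "u \<in> J"
  shows "x \<odot> (q \<odot> u) = q \<odot> (x \<odot> u)"
  using jordan_polarised[of q x u] idempotent_simps[OF q] x u
  by (simp add: algebra_simps scaleR_2)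

lemma idempotent_mult_commute_0:
  assumes q: "idempotent \<J> q" and x: "x \<in> J" "q \<odot> x = 0" and u: "u \<in> J"
  shows "x \<odot> (q \<odot> u) = q \<odot> (x \<odot> u)"
  using jordan_polarised[of q x u] idempotent_simps[OF q] x u
  by (simp add: algebra_simps)

lemma peirce_1_closed:
  assumes "idempotent \<J> q" "x \<in> J" "q \<odot> x = x" "y \<in> J" "q \<odot> y = y"
  shows "q \<odot> (x \<odot> y) = x \<odot> y"
  using idempotent_mult_commute[of q x y] assms by simp

text \<open>Multiplication by \<open>q\<close> commutes with multiplication by \<open>x\<close> and
  by \<open>y\<close>. Applied to the other element, one of these facts says that \<open>q\<close>
  fixes the product, the other that \<open>q\<close> annihilates it.\<close>

lemma peirce_1_0:
  assumes q: "idempotent \<J> q" and x: "x \<in> J" "q \<odot> x = x" and y: "y \<in> J" "q \<odot> y = 0"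
  shows "x \<odot> y = 0"
proof -
  have "y \<odot> (q \<odot> x) = q \<odot> (y \<odot> x)" "x \<odot> (q \<odot> y) = q \<odot> (x \<odot> y)"
    using idempotent_mult_commute_0[OF q y x(1)] idempotent_mult_commute[OF q x y(1)] .
  then show ?thesis using x y mult_commute[of x y] by simp
qed

text \<open>With L the multiplication by \<open>q\<close> this is 2L^3 - 3L^2 + L = 0: the only
  possible eigenvalues of L are 0, 1/2 and 1.\<close>

lemma idempotent_cubic:
  assumes q: "idempotent \<J> q" and u: "u \<in> J"
  shows "2 *\<^sub>R (q \<odot> (q \<odot> (q \<odot> u))) = 3 *\<^sub>R (q \<odot> (q \<odot> u)) - q \<odot> u"
proof -
  have "q \<odot> u = q \<odot> (q \<odot> u) + 2 *\<^sub>R (q \<odot> (q \<odot> u)) - 2 *\<^sub>R (q \<odot> (q \<odot> (q \<odot> u)))"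
    using mult_square_mult[of q q u] idempotent_simps[OF q] u by simp
  moreover have "3 *\<^sub>R (q \<odot> (q \<odot> u)) = q \<odot> (q \<odot> u) + 2 *\<^sub>R (q \<odot> (q \<odot> u))"
    using scaleR_add_left[of 1 2 "q \<odot> (q \<odot> u)"] by simp
  ultimately show ?thesis by (simp add: algebra_simps)
qed

text \<open>Only carrier and unit change, the product is inherited; results of this locale can thus
  be reused inside a Peirce 1-space.\<close>

definition peirce_1 :: "'v \<Rightarrow> 'v jordan" where
  "peirce_1 q = \<lparr>jcarrier = {x \<in> J. q \<odot> x = x}, jmult = jmult \<J>, junit = q\<rparr>"

lemma peirce_1_simps [simp]:
  "jcarrier (peirce_1 q) = {x \<in> J. q \<odot> x = x}" "jmult (peirce_1 q) = jmult \<J>" "junit (peirce_1 q) = q"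
  by (simp_all add: peirce_1_def)

lemma euclidean_jordan_algebra_peirce_1:
  assumes q: "idempotent \<J> q"
  shows "euclidean_jordan_algebra (peirce_1 q)"
proof
  show sub: "subspace (jcarrier (peirce_1 q))"
    using idempotent_simps(1)[OF q]
    by (auto simp: subspace_def mult_add_right mult_scaleR_right)
  obtain B where B: "finite B" "span B = J" using finite_dim by blast
  obtain C where C: "C \<subseteq> jcarrier (peirce_1 q)" "independent C" "jcarrier (peirce_1 q) \<subseteq> span C"
    using maximal_independent_subset by blast
  have "finite C"
    using independent_span_bound[OF B(1) C(2)] C(1) B(2) by auto
  moreover have "span C = jcarrier (peirce_1 q)"
    using C sub by (metis span_subspace)
  ultimately show "\<exists>C. finite C \<and> span C = jcarrier (peirce_1 q)" by blast
qed (use idempotent_simps[OF q] in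
     \<open>auto simp: mult_add mult_scaleR peirce_1_closed[OF q]
       intro: jordan_identity mult_commute inner_assoc\<close>)

section \<open>Powers and polynomials in one element\<close>

definition jpow :: "'v \<Rightarrow> nat \<Rightarrow> 'v" where
  "jpow x n = (jmult \<J> x ^^ n) \<e>"

lemma jpow_0 [simp]: "jpow x 0 = \<e>" and jpow_Suc [simp]: "jpow x (Suc n) = x \<odot> jpow x n"
  by (simp_all add: jpow_def)

lemma jpow_carrier [simp]: "x \<in> J \<Longrightarrow> jpow x n \<in> J"
  by (induction n) simp_all

lemma square_mult_jpow: "x \<in> J \<Longrightarrow> (x \<odot> x) \<odot> jpow x n = jpow x (Suc (Suc n))"
  by (induction n) (simp_all add: jordan_identity)

text \<open>The operator of the power n + 2 is an expression in the operators of the powers n, n + 1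
  and of x and x^2. This calls for induction in steps of two, and for commutation with x and x^2 to
  be proved together.\<close>

lemma jpow_commute:
  assumes x: "x \<in> J"
  shows "u \<in> J \<Longrightarrow> jpow x n \<odot> (x \<odot> u) = x \<odot> (jpow x n \<odot> u) \<and>
    jpow x n \<odot> ((x \<odot> x) \<odot> u) = (x \<odot> x) \<odot> (jpow x n \<odot> u)"
proof (induction n arbitrary: u rule: induct_nat_012)
  case 0
  then show ?case using x by (simp add: unit_mult)
next
  case 1
  then show ?case using x by (simp add: jordan_identity)
next
  case (ge2 n)
  have step: "jpow x (Suc (Suc n)) \<odot> w = (x \<odot> x) \<odot> (jpow x n \<odot> w) + 2 *\<^sub>R (jpow x (Suc n) \<odot> (x \<odot> w))
      - 2 *\<^sub>R (x \<odot> (jpow x n \<odot> (x \<odot> w)))" if "w \<in> J" for w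
    using mult_square_mult[of x "jpow x n" w] square_mult_jpow[OF x, of n] that x by simp
  define P Q where "P = jpow x n" and "Q = jpow x (Suc n)"
  note IH = ge2(1,2)[folded P_def Q_def]
  have PQ [simp]: "P \<in> J" "Q \<in> J" using x by (simp_all add: P_def Q_def del: jpow_Suc)
  note step = step[folded P_def Q_def]
  show ?case
    using x \<open>u \<in> J\<close> by (simp add: step mult_distribs jordan_identity IH del: jpow_Suc)
qed

lemma jpow_span_commute:
  assumes x: "x \<in> J" and w: "w \<in> span (range (jpow x))" and u: "u \<in> J"
  shows "w \<odot> (x \<odot> u) = x \<odot> (w \<odot> u)"
proof -
  have "w \<in> J \<and> w \<odot> (x \<odot> u) = x \<odot> (w \<odot> u)"
    using w
    by (induction rule: span_induct_alt)
       (use x u jpow_commute[OF x u] in \<open>auto simp: mult_distribs\<close>)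
  then show ?thesis by simp
qed

text \<open>Evaluation at \<open>x\<close> by Horner's scheme, which fixes the bracketing; this
  matters because the product is not associative.\<close>

definition jpoly :: "'v \<Rightarrow> real poly \<Rightarrow> 'v" where
  "jpoly x p = fold_coeffs (\<lambda>a v. a *\<^sub>R \<e> + x \<odot> v) p 0"

lemma jpoly_0 [simp]: "jpoly x 0 = 0"
  by (simp add: jpoly_def)

lemma jpoly_pCons [simp]: "x \<in> J \<Longrightarrow> jpoly x (pCons a p) = a *\<^sub>R \<e> + x \<odot> jpoly x p"
  by (cases "p = 0"; cases "a = 0") (simp_all add: jpoly_def)

lemma jpoly_carrier [simp]: "x \<in> J \<Longrightarrow> jpoly x p \<in> J"
  by (induction p) simp_all

lemma jpoly_span:
  assumes "x \<in> J" shows "jpoly x p \<in> span (range (jpow x))"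
proof (induction p)
  case (pCons a p)
  have "x \<odot> w \<in> span (range (jpow x))" if "w \<in> span (range (jpow x))" for w
  proof -
    have "w \<in> J \<and> x \<odot> w \<in> span (range (jpow x))" using that
    proof (induction rule: span_induct_alt)
      case (step c v w)
      then obtain n where "v = jpow x n" by auto
      then show ?case
        using step assms span_base[OF rangeI, of "jpow x" "Suc n"]
        by (auto simp: mult_distribs intro!: span_add span_scale)
    qed (use assms in \<open>simp_all add: span_zero\<close>)
    then show ?thesis by simp
  qed
  moreover have "\<e> \<in> span (range (jpow x))"
    using span_base[OF rangeI, of "jpow x" 0] by simp
  ultimately show ?case using assms pCons by (simp add: span_add span_scale)
qed (simp add: span_zero)

lemma jpoly_add: "x \<in> J \<Longrightarrow> jpoly x (p + q) = jpoly x p + jpoly x q"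
  by (induction p q rule: poly_induct2) (simp_all add: mult_add_right scaleR_add_left)

lemma jpoly_smult: "x \<in> J \<Longrightarrow> jpoly x (smult c p) = c *\<^sub>R jpoly x p"
  by (induction p) (simp_all add: mult_scaleR_right scaleR_add_right)

lemma jpoly_diff: "x \<in> J \<Longrightarrow> jpoly x (p - q) = jpoly x p - jpoly x q"
  using jpoly_add[of x p "smult (- 1) q"] jpoly_smult[of x "- 1" q] by simp

lemma jpoly_sum: "x \<in> J \<Longrightarrow> jpoly x (\<Sum>i\<in>A. f i) = (\<Sum>i\<in>A. jpoly x (f i))"
  by (induction A rule: infinite_finite_induct) (simp_all add: jpoly_add)

lemma jpoly_monom: "x \<in> J \<Longrightarrow> jpoly x (monom c n) = c *\<^sub>R jpow x n"
  by (induction n) (simp_all add: monom_0 monom_Suc mult_scaleR_right)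

lemma jpoly_annihilator:
  assumes x: "x \<in> J"
  obtains p where "p \<noteq> 0" "jpoly x p = 0"
proof -
  obtain B where B: "finite B" "span B = J" using finite_dim by blast
  define n where "n = card B"
  show ?thesis
  proof (cases "inj_on (jpow x) {..n}")
    case True
    let ?S = "jpow x ` {..n}"
    have "\<not> independent ?S"
    proof
      assume "independent ?S"
      moreover have "?S \<subseteq> span B" unfolding B(2) using x by (intro image_subsetI jpow_carrier)
      ultimately have "card ?S \<le> card B"
        using independent_span_bound[OF B(1), THEN conjunct2] by iprover
      then show False using True by (simp add: card_image n_def)
    qed
    then have "\<exists>u. (\<exists>v\<in>?S. u v \<noteq> 0) \<and> (\<Sum>v\<in>?S. u v *\<^sub>R v) = 0"
      unfolding dependent_finite[OF finite_imageI[OF finite_atMost]] not_not .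
    then obtain u v where u: "v \<in> ?S" "u v \<noteq> 0" "(\<Sum>v\<in>?S. u v *\<^sub>R v) = 0"
      by blast
    define p where "p = (\<Sum>i\<le>n. monom (u (jpow x i)) i)"
    have "jpoly x p = (\<Sum>i\<le>n. u (jpow x i) *\<^sub>R jpow x i)"
      by (simp add: p_def jpoly_sum jpoly_monom x)
    also have "\<dots> = 0"
      using u(3) True by (simp add: sum.reindex)
    finally have "jpoly x p = 0" .
    moreover obtain i where "i \<le> n" "v = jpow x i" using u(1) by auto
    then have "coeff p i \<noteq> 0"
      using u(2) by (simp add: p_def coeff_sum if_distrib cong: if_cong)
    then have "p \<noteq> 0" by auto
    ultimately show ?thesis using that by blast
  next
    \<comment> \<open>Coinciding powers make the image set smaller, so counting its elements proves
      nothing; but the equality of two powers is itself a relation.\<close>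
    case False
    then obtain i j where ij: "i \<noteq> j" "jpow x i = jpow x j" by (auto simp: inj_on_def)
    have "jpoly x (monom 1 i + monom (-1) j) = 0"
      using ij by (simp add: jpoly_add jpoly_monom x)
    moreover have "coeff (monom 1 i + monom (-1) j :: real poly) i \<noteq> 0"
      using ij by simp
    then have "monom 1 i + monom (-1) j \<noteq> (0 :: real poly)" by (metis coeff_0)
    ultimately show ?thesis using that by blast
  qed
qed

lemma inner_square_unit: "x \<in> J \<Longrightarrow> inner (x \<odot> x) \<e> = inner x x"
  using inner_assoc[of x x \<e>] by simp

text \<open>Write the minimal polynomial of \<open>x\<close> as (X - l) g. Then v = g(x) is a
  nonzero eigenvector with v^2 = g(l) v. Positivity of the inner product makes v^2 nonzero, so v /
  g(l) exists and is idempotent.\<close>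

lemma eigen_idempotent_exists:
  assumes x: "x \<in> J" and e: "\<e> \<noteq> 0"
  obtains c l where "idempotent \<J> c" "c \<noteq> 0" "x \<odot> c = l *\<^sub>R c"
proof -
  define p where "p = (ARG_MIN degree p. p \<noteq> 0 \<and> jpoly x p = 0)"
  obtain p0 where p0: "p0 \<noteq> 0 \<and> jpoly x p0 = 0" using jpoly_annihilator[OF x] by blast
  have p: "p \<noteq> 0" "jpoly x p = 0"
    using arg_min_natI[of "\<lambda>p. p \<noteq> 0 \<and> jpoly x p = 0", OF p0] by (auto simp: p_def)
  have min: "degree p \<le> degree g" if "g \<noteq> 0" "jpoly x g = 0" for g
    using arg_min_nat_le[of "\<lambda>p. p \<noteq> 0 \<and> jpoly x p = 0"] that by (auto simp: p_def)
  have "degree p > 0"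
  proof (rule ccontr)
    assume "\<not> degree p > 0"
    then obtain a where "p = [:a:]" by (auto elim: degree_eq_zeroE)
    then show False using p e x by auto
  qed
  then obtain l g where pg: "p = [:- l, 1:] * g"
  proof (cases rule: real_poly_factor)
    \<comment> \<open>An irreducible quadratic factor is impossible: with v = g(x) and w = (x - a)
      v, pairing p(x) = 0 with v gives |w|^2 + b^2 |v|^2 = 0, whereas v is nonzero by
      minimality.\<close>
    case (2 a b g)
    have "g \<noteq> 0" using p(1) 2 by auto
    moreover have "degree p = 2 + degree g"
      unfolding 2(2) using \<open>g \<noteq> 0\<close> by (subst degree_mult_eq) auto
    ultimately have ne: "jpoly x g \<noteq> 0" using min[of g] by auto
    define v where "v = jpoly x g"
    define w where "w = x \<odot> v - a *\<^sub>R v"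
    have v: "v \<in> J" and w: "w \<in> J" using x by (simp_all add: v_def w_def)
    have "(a * 2) *\<^sub>R (x \<odot> v) = a *\<^sub>R (x \<odot> v) + a *\<^sub>R (x \<odot> v)"
      by (simp flip: scaleR_add_left)
    then have "0 = x \<odot> w - a *\<^sub>R w + b\<^sup>2 *\<^sub>R v"
      using p(2) x v
      by (simp add: 2 v_def[symmetric] w_def mult_distribs jpoly_add jpoly_diff jpoly_smult algebra_simps power2_eq_square scaleR_2)
    then have "0 = inner v (x \<odot> w - a *\<^sub>R w + b\<^sup>2 *\<^sub>R v)" by simp
    also have "\<dots> = inner w w + b\<^sup>2 * inner v v"
      using inner_mult_left[OF x v w] inner_diff_left[of "x \<odot> v" "a *\<^sub>R v" w]
      by (simp add: inner_right_distrib inner_diff_right flip: w_def)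
    finally have "b\<^sup>2 * inner v v \<le> 0" using inner_ge_zero[of w] by linarith
    moreover have "b\<^sup>2 * inner v v > 0" using \<open>b \<noteq> 0\<close> ne by (simp add: v_def)
    ultimately have False by simp
    then show ?thesis ..
  qed
  define v where "v = jpoly x g"
  have "g \<noteq> 0" using p(1) pg by auto
  moreover have "degree p = 1 + degree g"
    unfolding pg using \<open>g \<noteq> 0\<close> by (subst degree_mult_eq) auto
  ultimately have v0: "v \<noteq> 0" using min[of g] by (auto simp: v_def)
  have vJ: "v \<in> J" using x by (simp add: v_def)
  have xv: "x \<odot> v = l *\<^sub>R v"
    using p(2) x by (simp add: pg v_def jpoly_diff jpoly_smult)
  \<comment> \<open>In a nonassociative product an eigenvector of \<open>x\<close> need not behave
    well under polynomials in \<open>x\<close>. Here \<open>v\<close> is itself such a polynomial,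
    so its multiplication operator commutes with that of \<open>x\<close>.\<close>
  have "v \<odot> jpoly x q = poly q l *\<^sub>R v" for q
  proof (induction q)
    case (pCons a q)
    then show ?case
      using x vJ xv jpow_span_commute[OF x jpoly_span[OF x, of g], of "jpoly x q"]
      by (simp add: mult_distribs v_def[symmetric] algebra_simps)
  qed (use vJ in simp)
  then have vv: "v \<odot> v = poly g l *\<^sub>R v" by (simp add: v_def)
  moreover have "v \<odot> v \<noteq> 0" using inner_square_unit[OF vJ] v0 by auto
  ultimately have gl: "poly g l \<noteq> 0" by auto
  define c where "c = (1 / poly g l) *\<^sub>R v"
  have "idempotent \<J> c"
    using vJ gl vv by (simp add: idempotent_def c_def mult_distribs)
  moreover have "c \<noteq> 0" "x \<odot> c = l *\<^sub>R c"
    using v0 gl xv vJ x by (simp_all add: c_def mult_distribs)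
  ultimately show ?thesis using that by blast
qed

section \<open>Orthogonal idempotents and the spectral theorem\<close>

definition orthogonal_idempotents :: "'v set \<Rightarrow> bool" where
  "orthogonal_idempotents F \<longleftrightarrow> finite F \<and> (\<forall>q\<in>F. idempotent \<J> q \<and> q \<noteq> 0) \<and>
     (\<forall>q\<in>F. \<forall>q'\<in>F. q \<noteq> q' \<longrightarrow> q \<odot> q' = 0)"

lemma orthogonal_idempotentsD:
  assumes "orthogonal_idempotents F"
  shows "finite F" "q \<in> F \<Longrightarrow> idempotent \<J> q" "q \<in> F \<Longrightarrow> q \<noteq> 0" "q \<in> F \<Longrightarrow> q \<in> J"
    "q \<in> F \<Longrightarrow> q \<odot> q = q" "q \<in> F \<Longrightarrow> q' \<in> F \<Longrightarrow> q \<noteq> q' \<Longrightarrow> q \<odot> q' = 0"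
  using assms by (auto simp: orthogonal_idempotents_def idempotent_def)

lemma orthogonal_mult_sum:
  assumes F: "orthogonal_idempotents F" and q: "q \<in> F"
  shows "q \<odot> (\<Sum>q\<in>F. l q *\<^sub>R q) = l q *\<^sub>R q"
proof -
  have "q \<odot> (\<Sum>q\<in>F. l q *\<^sub>R q) = (\<Sum>p\<in>F. l p *\<^sub>R (q \<odot> p))"
    using orthogonal_idempotentsD[OF F] q by (simp add: mult_sum_right mult_scaleR_right)
  also have "\<dots> = (\<Sum>p\<in>F. if p = q then l p *\<^sub>R p else 0)"
    using orthogonal_idempotentsD[OF F] q by (intro sum.cong) auto
  finally show ?thesis using orthogonal_idempotentsD[OF F] q by simp
qed

text \<open>Multiplying a linear relation by one member isolates its coefficient, so the set is
  independent. The bound guarantees that a largest eigensystem exists.\<close>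

lemma card_orthogonal_idempotents:
  assumes B: "finite B" "span B = J" and F: "orthogonal_idempotents F"
  shows "card F \<le> card B"
proof -
  have "independent F"
  proof
    assume "dependent F"
    then obtain u v where u: "v \<in> F" "u v \<noteq> 0" "(\<Sum>v\<in>F. u v *\<^sub>R v) = 0"
      unfolding dependent_finite[OF orthogonal_idempotentsD(1)[OF F]] by blast
    then show False
      using orthogonal_mult_sum[OF F u(1), of u] orthogonal_idempotentsD[OF F] by simp
  qed
  moreover have "F \<subseteq> span B" unfolding B(2) using orthogonal_idempotentsD(4)[OF F] by blast
  ultimately show ?thesis
    using independent_span_bound[OF B(1), THEN conjunct2] by iprover
qed

lemma idempotent_add_orthogonal:
  assumes "idempotent \<J> a" "idempotent \<J> b" "idempotent \<J> (a + b)"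
  shows "a \<odot> b = 0"
proof -
  have "2 *\<^sub>R (a \<odot> b) = 0"
    using assms mult_commute[of a b] by (auto simp: idempotent_def mult_distribs scaleR_2)
  then show ?thesis by simp
qed

lemma idempotent_complement:
  assumes F: "orthogonal_idempotents F"
  shows "idempotent \<J> (\<e> - \<Sum>F)" "q \<in> F \<Longrightarrow> (\<e> - \<Sum>F) \<odot> q = 0"
proof -
  have sum: "\<Sum>F \<in> J" using orthogonal_idempotentsD(4)[OF F] by simp
  have q: "q \<odot> \<Sum>F = q" if "q \<in> F" for q using orthogonal_mult_sum[OF F that, of "\<lambda>_. 1"] by simp
  have "\<Sum>F \<odot> \<Sum>F = \<Sum>F"
    using orthogonal_idempotentsD(4)[OF F] sum q by (subst mult_sum_left) auto
  then show "idempotent \<J> (\<e> - \<Sum>F)"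
    using sum by (simp add: idempotent_def mult_distribs unit_mult)
  show "(\<e> - \<Sum>F) \<odot> q = 0" if "q \<in> F"
    using q[OF that] sum orthogonal_idempotentsD(4)[OF F that] mult_commute[of q "\<Sum>F"]
    by (simp add: mult_distribs unit_mult)
qed

text \<open>A frame in the making: summing to the unit and primitivity of the members are later
  obtained from maximal cardinality.\<close>

definition eigensystem :: "'v \<Rightarrow> 'v set \<Rightarrow> bool" where
  "eigensystem x F \<longleftrightarrow> orthogonal_idempotents F \<and> (\<forall>q\<in>F. \<exists>l. x \<odot> q = l *\<^sub>R q)"

lemma eigensystem_eigenvalues:
  assumes "eigensystem x F"
  obtains l where "\<And>q. q \<in> F \<Longrightarrow> x \<odot> q = l q *\<^sub>R q"
proof -
  have "\<forall>q\<in>F. \<exists>l. x \<odot> q = l *\<^sub>R q" using assms by (simp add: eigensystem_def)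
  then obtain l where "\<forall>q\<in>F. x \<odot> q = l q *\<^sub>R q" by (rule bchoice[THEN exE])
  then show ?thesis using that by blast
qed

lemma eigensystem_insert:
  assumes F: "eigensystem x F" and c: "idempotent \<J> c" "c \<noteq> 0" "x \<odot> c = l *\<^sub>R c"
    and "\<And>q. q \<in> F \<Longrightarrow> c \<odot> q = 0"
  shows "eigensystem x (insert c F)" "c \<notin> F"
proof -
  have "q \<odot> c = 0" if "q \<in> F" for q
    using that assms mult_commute[of c q]
    by (auto simp: eigensystem_def orthogonal_idempotents_def idempotent_def)
  then show "eigensystem x (insert c F)"
    using assms by (auto simp: eigensystem_def orthogonal_idempotents_def)
  show "c \<notin> F" using assms(2-5) by (auto simp: idempotent_def)
qed

text \<open>The complement \<open>s\<close> of the sum is a nonzero idempotent whose Peirce 1-space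
  contains \<open>x \<odot> s\<close>. An eigen-idempotent found there is orthogonal to
  \<open>F\<close>, and \<open>x\<close> acts on it as \<open>x \<odot> s\<close> does, because the
  rest of \<open>x\<close> is a combination of members of \<open>F\<close>.\<close>

lemma eigensystem_extend:
  assumes x: "x \<in> J" and F: "eigensystem x F" and s: "\<Sum>F \<noteq> \<e>"
  obtains c where "eigensystem x (insert c F)" "c \<notin> F"
proof -
  have orth: "orthogonal_idempotents F" using F by (simp add: eigensystem_def)
  note F' = orthogonal_idempotentsD[OF orth]
  define s where "s = \<e> - \<Sum>F"
  have sid: "idempotent \<J> s" and sq: "\<And>q. q \<in> F \<Longrightarrow> s \<odot> q = 0"
    using idempotent_complement[OF orth] by (simp_all add: s_def)
  have sJ: "s \<in> J" "s \<odot> s = s" using sid by (simp_all add: idempotent_def)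
  obtain l where l: "\<And>q. q \<in> F \<Longrightarrow> x \<odot> q = l q *\<^sub>R q"
    using eigensystem_eigenvalues[OF F] by blast
  define y where "y = x \<odot> s"
  have y_eq: "y = x - (\<Sum>q\<in>F. l q *\<^sub>R q)"
    using x F' l by (simp add: y_def s_def mult_distribs mult_sum_right)
  have y: "y \<in> J" using x sJ by (simp add: y_def)
  have "s \<odot> x = y" using x sJ mult_commute by (simp add: y_def)
  then have sy: "s \<odot> y = y"
    using sJ x sq F' by (simp add: y_eq mult_distribs mult_sum_right)
  interpret S: euclidean_jordan_algebra "peirce_1 s"
    by (rule euclidean_jordan_algebra_peirce_1[OF sid])
  obtain c k where c: "idempotent (peirce_1 s) c" "c \<noteq> 0" "y \<odot> c = k *\<^sub>R c"
    using S.eigen_idempotent_exists[of y] y sy s by (auto simp: s_def)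
  have cJ: "idempotent \<J> c" "s \<odot> c = c" "c \<in> J" using c(1) by (auto simp: idempotent_def)
  have cq: "c \<odot> q = 0" if "q \<in> F" for q
    using peirce_1_0[OF sid cJ(3,2)] sq that F' by simp
  have "x = y + (\<Sum>q\<in>F. l q *\<^sub>R q)" by (simp add: y_eq)
  also have "\<dots> \<odot> c = y \<odot> c + (\<Sum>q\<in>F. l q *\<^sub>R (q \<odot> c))"
    using y cJ F' by (simp add: mult_distribs mult_sum_left)
  also have "(\<Sum>q\<in>F. l q *\<^sub>R (q \<odot> c)) = 0"
    using cq mult_commute[of c] cJ F' by (intro sum.neutral) auto
  finally have "x \<odot> c = k *\<^sub>R c" using c by simp
  then show ?thesis using eigensystem_insert[OF F cJ(1) c(2) _ cq] that by blast
qed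

text \<open>If q = a + b, both parts lie in the Peirce 1-space of \<open>q\<close>, while
  \<open>x - l *\<^sub>R q\<close> and the other members of \<open>F\<close> lie in its Peirce
  0-space. Hence \<open>x\<close> acts on both parts as the scalar \<open>l\<close>, and they can
  replace \<open>q\<close>.\<close>

lemma eigensystem_split:
  assumes x: "x \<in> J" and F: "eigensystem x F" and q: "q \<in> F" "\<not> primitive_idempotent \<J> q"
  obtains F' where "eigensystem x F'" "card F < card F'"
proof -
  have orth: "orthogonal_idempotents F" using F by (simp add: eigensystem_def)
  note F' = orthogonal_idempotentsD[OF orth]
  obtain a b where ab: "idempotent \<J> a" "idempotent \<J> b" "a \<noteq> 0" "b \<noteq> 0" "q = a + b"
    using q F' by (auto simp: primitive_idempotent_def)
  have J: "a \<in> J" "b \<in> J" "a \<odot> a = a" "b \<odot> b = b" using ab by (simp_all add: idempotent_def)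
  have o: "a \<odot> b = 0" using idempotent_add_orthogonal[OF ab(1,2)] F'(2)[OF q(1)] ab(5) by simp
  then have o': "b \<odot> a = 0" using J mult_commute by metis
  obtain l where l: "x \<odot> q = l *\<^sub>R q" using F q by (auto simp: eigensystem_def)
  have qid: "idempotent \<J> q" using F' q by blast
  have qab: "q \<odot> a = a" "q \<odot> b = b" using J o o' by (simp_all add: ab(5) mult_add)
  define y where "y = x - l *\<^sub>R q"
  have "q \<in> J" using F' q by blast
  then have y: "y \<in> J" "q \<odot> y = 0"
    using x l mult_commute[of x q] idempotent_simps[OF qid] by (simp_all add: y_def mult_distribs)
  have eig: "x \<odot> c = l *\<^sub>R c" if "c \<in> J" "q \<odot> c = c" for c
    using peirce_1_0[OF qid that y] mult_commute[of c y] that x y \<open>q \<in> J\<close>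
    by (simp add: y_def mult_distribs)
  have orth_c: "c \<odot> q' = 0" if "c \<in> J" "q \<odot> c = c" "q' \<in> F - {q}" for c q'
    using peirce_1_0[OF qid that(1,2)] that F' q by auto
  have "eigensystem x (F - {q})"
    using F by (auto simp: eigensystem_def orthogonal_idempotents_def)
  then have b: "eigensystem x (insert b (F - {q}))" "b \<notin> F - {q}"
    using eigensystem_insert[OF _ ab(2,4) eig] J qab orth_c by blast+
  have a: "eigensystem x (insert a (insert b (F - {q})))" "a \<notin> insert b (F - {q})"
    using eigensystem_insert[OF b(1) ab(1,3) eig] J qab orth_c o by blast+
  have "card (insert a (insert b (F - {q}))) = Suc (card F)"
    using a(2) b(2) F'(1) q(1) by (simp add: card_Diff_singleton) (metis card_gt_0_iff empty_iff Suc_pred)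
  then show ?thesis using that a(1) by simp
qed

text \<open>An eigensystem of largest cardinality can be neither extended nor split, so it is a
  Jordan frame; applying \<open>x\<close> to its sum gives the decomposition.\<close>

theorem spectral_decomposition_exists:
  assumes x: "x \<in> J"
  obtains F l where "spectral_decomposition \<J> x F l"
proof -
  obtain B where B: "finite B" "span B = J" using finite_dim by blast
  have "eigensystem x {}" by (simp add: eigensystem_def orthogonal_idempotents_def)
  moreover have "\<forall>F. eigensystem x F \<longrightarrow> card F < Suc (card B)"
    using card_orthogonal_idempotents[OF B] by (auto simp: eigensystem_def le_imp_less_Suc)
  ultimately obtain F where F: "eigensystem x F" and max: "\<And>F'. eigensystem x F' \<Longrightarrow> card F' \<le> card F"
    using ex_has_greatest_nat[of "eigensystem x" "{}" card] by blast
  have orth: "orthogonal_idempotents F" using F by (simp add: eigensystem_def)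
  note F' = orthogonal_idempotentsD[OF orth]
  have sum: "\<Sum>F = \<e>"
  proof (rule ccontr)
    assume "\<Sum>F \<noteq> \<e>"
    then obtain c where "eigensystem x (insert c F)" "c \<notin> F" using eigensystem_extend[OF x F] by blast
    then show False using max[of "insert c F"] F'(1) by simp
  qed
  moreover have "\<forall>q\<in>F. primitive_idempotent \<J> q"
    using eigensystem_split[OF x F] max by (metis not_less)
  ultimately have "jordan_frame \<J> F" using F' by (simp add: jordan_frame_def)
  obtain l where l: "\<And>q. q \<in> F \<Longrightarrow> x \<odot> q = l q *\<^sub>R q"
    using eigensystem_eigenvalues[OF F] by blast
  have "x = x \<odot> \<Sum>F" using x sum by simp
  also have "\<dots> = (\<Sum>q\<in>F. l q *\<^sub>R q)" using x F' l by (simp add: mult_sum_right)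
  finally show ?thesis using that \<open>jordan_frame \<J> F\<close> by (simp add: spectral_decomposition_def)
qed

end

section \<open>Trace\<close>

context euclidean_jordan_algebra
begin

lemma jordan_frameD:
  assumes "jordan_frame \<J> F"
  shows "orthogonal_idempotents F" "\<Sum>F = \<e>" "q \<in> F \<Longrightarrow> primitive_idempotent \<J> q" "finite F"
    "q \<in> F \<Longrightarrow> q \<in> J" "q \<in> F \<Longrightarrow> idempotent \<J> q"
  using assms
  by (auto simp: jordan_frame_def orthogonal_idempotents_def primitive_idempotent_def idempotent_def)

lemma primitive_idempotentD:
  assumes "primitive_idempotent \<J> q"
  shows "idempotent \<J> q" "q \<in> J" "q \<odot> q = q" "q \<noteq> 0" "0 < inner q q"
  using assms by (auto simp: primitive_idempotent_def idempotent_def)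

text \<open>An eigen-idempotent c of \<open>x\<close> inside the Peirce 1-space must be
  \<open>q\<close> itself, for otherwise q = c + (q - c) would split \<open>q\<close>.\<close>

lemma primitive_peirce_1:
  assumes q: "primitive_idempotent \<J> q" and x: "x \<in> J" "q \<odot> x = x"
  obtains l where "x = l *\<^sub>R q"
proof -
  note q' = primitive_idempotentD[OF q]
  interpret Q: euclidean_jordan_algebra "peirce_1 q"
    by (rule euclidean_jordan_algebra_peirce_1[OF q'(1)])
  obtain c l where c: "idempotent (peirce_1 q) c" "c \<noteq> 0" "x \<odot> c = l *\<^sub>R c"
    using Q.eigen_idempotent_exists[of x] x q'(4) by auto
  have c': "c \<in> J" "c \<odot> c = c" "q \<odot> c = c" "c \<odot> q = c"
    using c(1) mult_commute[of q c] q'(2) by (auto simp: idempotent_def)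
  have "c = q"
  proof (rule ccontr)
    assume "c \<noteq> q"
    moreover have "idempotent \<J> c" using c' by (simp add: idempotent_def)
    moreover have "idempotent \<J> (q - c)" using c' q' by (simp add: idempotent_def mult_distribs)
    ultimately show False
      using q c(2) unfolding primitive_idempotent_def by (metis add_diff_cancel_left' diff_add_cancel diff_self add.commute)
  qed
  then have "x = l *\<^sub>R q" using c(3) x q'(2) mult_commute[of q x] by simp
  then show ?thesis by (rule that)
qed

text \<open>2L^2 - L takes the values 1, 0, 0 at the eigenvalues 1, 1/2, 0 of L, so it projects onto
  the Peirce 1-space, which is the line through \<open>q\<close>. Pairing with \<open>q\<close>
  yields the coefficient.\<close>

lemma primitive_projection:
  assumes q: "primitive_idempotent \<J> q" and z: "z \<in> J"
  shows "2 *\<^sub>R (q \<odot> (q \<odot> z)) - q \<odot> z = (inner z q / inner q q) *\<^sub>R q"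
proof -
  note q' = primitive_idempotentD[OF q]
  define u where "u = 2 *\<^sub>R (q \<odot> (q \<odot> z)) - q \<odot> z"
  have u: "u \<in> J" using q' z by (simp add: u_def)
  have "q \<odot> u = 3 *\<^sub>R (q \<odot> (q \<odot> z)) - q \<odot> z - q \<odot> (q \<odot> z)"
    using idempotent_cubic[OF q'(1) z] q' z by (simp add: u_def mult_distribs)
  also have "\<dots> = u"
    using scaleR_add_left[of 2 1 "q \<odot> (q \<odot> z)"] by (simp add: u_def)
  finally obtain l where l: "u = l *\<^sub>R q" using primitive_peirce_1[OF q u] by blast
  have qz: "inner (q \<odot> v) q = inner v q" if "v \<in> J" for v
    using inner_mult_left[of q v q] q' that by simp
  have "inner u q = inner z q"
    using qz[of z] qz[of "q \<odot> z"] z q' by (simp add: u_def inner_diff_left)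
  then have "l * inner q q = inner z q" by (simp add: l)
  then show ?thesis using l q'(5) by (simp add: u_def field_simps)
qed

lemma primitive_norm_eq:
  assumes p: "primitive_idempotent \<J> p" and q: "primitive_idempotent \<J> q" and "inner p q \<noteq> 0"
  shows "inner p p = inner q q"
proof -
  \<comment> \<open>The right-hand side is symmetric in \<open>p\<close> and \<open>q\<close>, the left-hand side is not.\<close>
  have eq: "(inner p q / inner q q) * inner p q = 2 * inner (q \<odot> p) (q \<odot> p) - inner p q"
    if "primitive_idempotent \<J> p" "primitive_idempotent \<J> q" for p q
  proof -
    note p' = primitive_idempotentD[OF that(1)] and q' = primitive_idempotentD[OF that(2)]
    have "(inner p q / inner q q) * inner p q = inner (2 *\<^sub>R (q \<odot> (q \<odot> p)) - q \<odot> p) p"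
      using primitive_projection[OF that(2) p'(2)] by (simp add: inner_commute)
    also have "\<dots> = 2 * inner (q \<odot> p) (q \<odot> p) - inner p q"
      using inner_mult_left[of q "q \<odot> p" p] inner_assoc[of q p p] p' q'
      by (simp add: inner_diff_left inner_diff_right inner_commute)
    finally show ?thesis .
  qed
  have "p \<odot> q = q \<odot> p" using p q by (intro mult_commute) (auto dest: primitive_idempotentD)
  then have "(inner p q / inner p p) * inner p q = (inner p q / inner q q) * inner p q"
    using eq[OF p q] eq[OF q p] by (simp add: inner_commute)
  then show ?thesis
    using assms(3) primitive_idempotentD(5)[OF p] primitive_idempotentD(5)[OF q]
    by (simp add: field_simps)
qed

lemma frame_inner_sum:
  assumes F: "jordan_frame \<J> F" and p: "primitive_idempotent \<J> p"
  shows "(\<Sum>q\<in>F. inner p q / inner q q) = 1"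
proof -
  note p' = primitive_idempotentD[OF p]
  \<comment> \<open>If p and q are orthogonal the term is 0 with either denominator; otherwise their
    norms agree.\<close>
  have "(\<Sum>q\<in>F. inner p q / inner q q) = (\<Sum>q\<in>F. inner p q / inner p p)"
    using primitive_norm_eq[OF p jordan_frameD(3)[OF F]] by (intro sum.cong) force+
  also have "\<dots> = inner p \<e> / inner p p"
    using jordan_frameD(2)[OF F] by (simp flip: sum_divide_distrib inner_sum_right)
  also have "inner p \<e> = inner p p"
    using inner_assoc[of p p \<e>] p' by simp
  finally show ?thesis using p' by simp
qed

section \<open>The trace as a linear and associative form\<close>

definition trace_element :: "'v set \<Rightarrow> 'v" where
  "trace_element F = (\<Sum>q\<in>F. (1 / inner q q) *\<^sub>R q)"

lemma trace_element_carrier: "jordan_frame \<J> F \<Longrightarrow> trace_element F \<in> J"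
  by (auto simp: trace_element_def jordan_frameD)

lemma inner_trace_element:
  assumes F: "jordan_frame \<J> F" and x: "spectral_decomposition \<J> x G l"
  shows "inner x (trace_element F) = (\<Sum>q\<in>G. l q)"
proof -
  have G: "jordan_frame \<J> G" "x = (\<Sum>q\<in>G. l q *\<^sub>R q)" using x by (auto simp: spectral_decomposition_def)
  have "inner p (trace_element F) = 1" if "p \<in> G" for p
    using frame_inner_sum[OF F jordan_frameD(3)[OF G(1) that]]
    by (simp add: trace_element_def inner_sum_right)
  then show ?thesis by (simp add: G(2) inner_sum_left)
qed

text \<open>Paired with any element, both trace elements give the eigenvalue sum of that element;
  choose the element to be their difference.\<close>

lemma trace_element_unique:
  assumes "jordan_frame \<J> F" "jordan_frame \<J> G"
  shows "trace_element F = trace_element G"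
proof -
  let ?d = "trace_element F - trace_element G"
  have "?d \<in> J" using assms by (simp add: trace_element_carrier)
  then obtain H l where "spectral_decomposition \<J> ?d H l" by (rule spectral_decomposition_exists)
  then have "inner ?d ?d = 0"
    using inner_trace_element assms by (metis inner_diff_right right_minus_eq)
  then show ?thesis by simp
qed

lemma spectral_frame_exists:
  assumes "x \<in> J"
  obtains F l where "jordan_frame \<J> F" "x = (\<Sum>q\<in>F. l q *\<^sub>R q)"
proof -
  obtain F l where "spectral_decomposition \<J> x F l" using assms by (rule spectral_decomposition_exists)
  then show ?thesis using that unfolding spectral_decomposition_def by blast
qed

lemma spectral_decomposition_choice:
  assumes "x \<in> J"
  shows "spectral_decomposition \<J> x (spectral_frame \<J> x) (eigenvalue \<J> x)"
proof -
  obtain F l where "spectral_decomposition \<J> x F l" using assms by (rule spectral_decomposition_exists)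
  then have "case (F, l) of (F, l) \<Rightarrow> spectral_decomposition \<J> x F l" by simp
  then show ?thesis
    unfolding spectral_frame_def eigenvalue_def spectral_choice_def
    by (rule someI2) (auto split: prod.splits)
qed

lemma jtrace_eq_inner:
  assumes "jordan_frame \<J> F" "x \<in> J"
  shows "jtrace \<J> x = inner x (trace_element F)"
  using inner_trace_element[OF assms(1) spectral_decomposition_choice[OF assms(2)]]
  by (simp add: jtrace_def)

lemma jordan_frame_exists: obtains F where "jordan_frame \<J> F"
proof -
  obtain F l where "spectral_decomposition \<J> 0 F l" by (rule spectral_decomposition_exists[OF carrier_simps(3)])
  then show ?thesis using that unfolding spectral_decomposition_def by blast
qed

lemma jtrace_spectral:
  assumes "spectral_decomposition \<J> x F l"
  shows "jtrace \<J> x = (\<Sum>q\<in>F. l q)"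
proof -
  have F: "jordan_frame \<J> F" using assms by (simp add: spectral_decomposition_def)
  moreover have "x \<in> J" using assms jordan_frameD(5)[OF F] by (auto simp: spectral_decomposition_def)
  ultimately show ?thesis using inner_trace_element[OF F assms] by (simp add: jtrace_eq_inner)
qed

lemma jtrace_frame: "jordan_frame \<J> F \<Longrightarrow> jtrace \<J> (\<Sum>q\<in>F. l q *\<^sub>R q) = (\<Sum>q\<in>F. l q)"
  by (rule jtrace_spectral) (simp add: spectral_decomposition_def)

lemma jtrace_linear:
  "x \<in> J \<Longrightarrow> y \<in> J \<Longrightarrow> jtrace \<J> (x + y) = jtrace \<J> x + jtrace \<J> y"
  "x \<in> J \<Longrightarrow> y \<in> J \<Longrightarrow> jtrace \<J> (x - y) = jtrace \<J> x - jtrace \<J> y"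
  "x \<in> J \<Longrightarrow> jtrace \<J> (c *\<^sub>R x) = c * jtrace \<J> x"
  "x \<in> J \<Longrightarrow> jtrace \<J> (- x) = - jtrace \<J> x"
  "jtrace \<J> 0 = 0"
proof -
  obtain F where F: "jordan_frame \<J> F" by (rule jordan_frame_exists)
  show "x \<in> J \<Longrightarrow> y \<in> J \<Longrightarrow> jtrace \<J> (x + y) = jtrace \<J> x + jtrace \<J> y"
    "x \<in> J \<Longrightarrow> y \<in> J \<Longrightarrow> jtrace \<J> (x - y) = jtrace \<J> x - jtrace \<J> y"
    "x \<in> J \<Longrightarrow> jtrace \<J> (c *\<^sub>R x) = c * jtrace \<J> x"
    "x \<in> J \<Longrightarrow> jtrace \<J> (- x) = - jtrace \<J> x" "jtrace \<J> 0 = 0"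
    by (simp_all add: jtrace_eq_inner[OF F] inner_add_left inner_diff_left)
qed

lemma jtrace_sum: "(\<And>i. i \<in> A \<Longrightarrow> f i \<in> J) \<Longrightarrow> jtrace \<J> (sum f A) = (\<Sum>i\<in>A. jtrace \<J> (f i))"
  by (induction A rule: infinite_finite_induct) (simp_all add: jtrace_linear)

lemma jtrace_unit: "jtrace \<J> \<e> = real (jrank \<J>)"
proof -
  obtain F where "jordan_frame \<J> F" by (rule jordan_frame_exists)
  then have "jordan_frame \<J> (SOME F. jordan_frame \<J> F)" by (rule someI)
  from jtrace_frame[OF this, of "\<lambda>_. 1"] jordan_frameD(2)[OF this] show ?thesis
    by (simp add: jrank_def)
qed

lemma card_jordan_frame: "jordan_frame \<J> F \<Longrightarrow> card F = jrank \<J>"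
  using jtrace_frame[of F "\<lambda>_. 1"] jordan_frameD(2)[of F] by (simp add: jtrace_unit)

lemma frame_mult_commute:
  assumes F: "jordan_frame \<J> F" and "p \<in> F" "q \<in> F" "u \<in> J"
  shows "p \<odot> (q \<odot> u) = q \<odot> (p \<odot> u)"
  using idempotent_mult_commute_0[of p q u] orthogonal_idempotentsD[OF jordan_frameD(1)[OF F]] assms
  by (cases "p = q") auto

text \<open>By uniqueness the trace element can be written over a frame that diagonalises
  \<open>x\<close>, and multiplications by members of one frame commute.\<close>

lemma trace_element_mult_commute:
  assumes F: "jordan_frame \<J> F" and x: "x \<in> J" and y: "y \<in> J"
  shows "trace_element F \<odot> (x \<odot> y) = x \<odot> (trace_element F \<odot> y)"
proof -
  obtain G l where G: "jordan_frame \<J> G" and xG: "x = (\<Sum>q\<in>G. l q *\<^sub>R q)"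
    using x by (rule spectral_frame_exists)
  note [simp] = jordan_frameD(5)[OF G]
  have "trace_element G \<odot> (x \<odot> y)
      = (\<Sum>q\<in>G. \<Sum>p\<in>G. (l q / inner p p) *\<^sub>R (p \<odot> (q \<odot> y)))"
    using y by (simp add: trace_element_def xG mult_sum_left mult_sum_right mult_scaleR
      mult_scaleR_right scaleR_sum_right)
  also have "\<dots> = (\<Sum>q\<in>G. \<Sum>p\<in>G. (l q / inner p p) *\<^sub>R (q \<odot> (p \<odot> y)))"
    using frame_mult_commute[OF G _ _ y] by (intro sum.cong) auto
  also have "\<dots> = x \<odot> (trace_element G \<odot> y)"
    using y by (subst sum.swap) (simp add: trace_element_def xG mult_sum_left mult_sum_right mult_scaleR
      mult_scaleR_right scaleR_sum_right mult.commute)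
  finally show ?thesis using trace_element_unique[OF F G] by simp
qed

text \<open>Associativity is inherited from the ambient inner product, because the trace is the
  pairing with \<open>w\<close> and multiplication by \<open>w\<close> commutes with all other
  multiplications.\<close>

lemma jtrace_assoc:
  assumes "x \<in> J" "y \<in> J" "z \<in> J"
  shows "jtrace \<J> ((x \<odot> y) \<odot> z) = jtrace \<J> (x \<odot> (y \<odot> z))"
proof -
  obtain F where F: "jordan_frame \<J> F" by (rule jordan_frame_exists)
  define w where "w = trace_element F"
  note [simp] = assms trace_element_carrier[OF F, folded w_def]
  have "inner ((x \<odot> y) \<odot> z) w = inner (x \<odot> y) (z \<odot> w)" by (rule inner_assoc) auto
  also have "\<dots> = inner x (y \<odot> (w \<odot> z))" using inner_assoc[of x y "z \<odot> w"] mult_commute[of z w] by simp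
  also have "y \<odot> (w \<odot> z) = (y \<odot> z) \<odot> w"
    using trace_element_mult_commute[OF F, of y z, folded w_def] mult_commute[of "y \<odot> z" w] by simp
  also have "inner x \<dots> = inner (x \<odot> (y \<odot> z)) w" by (rule inner_assoc[symmetric]) auto
  finally show ?thesis by (simp add: jtrace_eq_inner[OF F] w_def)
qed

lemma jtrace_square_nonneg:
  assumes "x \<in> J" shows "0 \<le> jtrace \<J> (x \<odot> x)"
proof -
  obtain G l where G: "jordan_frame \<J> G" and xG: "x = (\<Sum>q\<in>G. l q *\<^sub>R q)"
    using assms by (rule spectral_frame_exists)
  have "x \<odot> x = (\<Sum>q\<in>G. l q *\<^sub>R (q \<odot> x))"
    using jordan_frameD[OF G] assms by (subst (1) xG) (simp add: mult_sum_left mult_scaleR)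
  also have "\<dots> = (\<Sum>q\<in>G. (l q)\<^sup>2 *\<^sub>R q)"
    using orthogonal_mult_sum[OF jordan_frameD(1)[OF G], of _ l] by (simp add: xG power2_eq_square)
  finally show ?thesis using jtrace_frame[OF G, of "\<lambda>q. (l q)\<^sup>2"] by (simp add: sum_nonneg)
qed

text \<open>With L the multiplication by \<open>q\<close>, the traces of uv, vv, wv and ww are the
  moments Tr(u L^k u) for k = 1, ..., 4, and the Peirce equation relates them linearly. Since only
  squares are known to have nonnegative trace, the first moment is expressed by traces of
  squares.\<close>

lemma idempotent_mult_psd:
  assumes q: "idempotent \<J> q" and u: "u \<in> J"
  shows "0 \<le> jtrace \<J> (q \<odot> (u \<odot> u))"
proof -
  have [simp]: "q \<in> J" "u \<in> J" using q u by (simp_all add: idempotent_def)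
  define v w where "v = q \<odot> u" and "w = q \<odot> v"
  have [simp]: "v \<in> J" "w \<in> J" by (simp_all add: v_def w_def)
  have sym: "jtrace \<J> ((q \<odot> a) \<odot> b) = jtrace \<J> (a \<odot> (q \<odot> b))" if "a \<in> J" "b \<in> J" for a b
    using jtrace_assoc[of a q b] mult_commute[of a q] that by simp
  have cub: "2 *\<^sub>R (q \<odot> w) = 3 *\<^sub>R w - v"
    using idempotent_cubic[OF q u] by (simp add: v_def w_def)
  let ?T = "\<lambda>a b. jtrace \<J> (a \<odot> b)"
  have com: "?T a b = ?T b a" if "a \<in> J" "b \<in> J" for a b using mult_commute that by simp
  have a2: "?T v v = ?T u w" using sym[of u v] by (simp add: v_def w_def)
  have a3: "2 * ?T w v = 3 * ?T v v - ?T u v"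
  proof -
    have "2 * ?T w v = ?T u (2 *\<^sub>R (q \<odot> w))"
      using sym[of u w] com[of v w] by (simp add: mult_scaleR_right jtrace_linear flip: v_def)
    then show ?thesis unfolding cub by (simp add: mult_distribs jtrace_linear a2)
  qed
  have a4: "2 * ?T w w = 3 * ?T w v - ?T v v"
  proof -
    have "2 * ?T w w = ?T v (2 *\<^sub>R (q \<odot> w))"
      using sym[of v w] by (simp add: mult_scaleR_right jtrace_linear flip: w_def)
    then show ?thesis unfolding cub using com[of v w] by (simp add: mult_distribs jtrace_linear)
  qed
  \<comment> \<open>2L^2 - L selects the Peirce 1-part of \<open>u\<close>, and L - L^2 a quarter of
    its 1/2-part. The first moment is the first of these traces plus 8 times the second.\<close>
  have "0 \<le> ?T (2 *\<^sub>R w - v) (2 *\<^sub>R w - v)" "0 \<le> ?T (v - w) (v - w)"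
    by (rule jtrace_square_nonneg; simp)+
  then have "0 \<le> 4 * ?T w w - 4 * ?T w v + ?T v v" "0 \<le> ?T v v - 2 * ?T w v + ?T w w"
    using com[of v w] by (simp_all add: mult_distribs jtrace_linear)
  then have "0 \<le> ?T u v" using a3 a4 by argo
  also have "?T u v = jtrace \<J> (q \<odot> (u \<odot> u))"
    using jtrace_assoc[of q u u] com[of u v] by (simp add: v_def)
  finally show ?thesis .
qed

end

section \<open>Multiplicative weights\<close>

text \<open>The usual remainder has the exponential at an intermediate point, which depends on both
  \<open>a\<close> and \<open>b\<close>. In the symmetric bound each term contains the exponential
  of only one of them, so that summing over two frames gives traces again.\<close>

lemma exp_taylor_bound:
  fixes a b :: real
  shows "exp a - exp b - exp b * (a - b) \<le> (a - b)\<^sup>2 * (exp a + exp b) / 2"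
proof -
  define d where "d = a - b"
  have *: "exp d - 1 - d \<le> d\<^sup>2 * (exp d + 1) / 2"
  proof -
    obtain t where t: "\<bar>t\<bar> \<le> \<bar>d\<bar>" "exp d = (\<Sum>m<2. d ^ m / fact m) + exp t / fact 2 * d ^ 2"
      using Maclaurin_exp_le[of d 2] by blast
    have "0 \<le> d\<^sup>2 * (exp d + 1) / 2 - (exp d - 1 - d)"
    proof (cases "d \<ge> 0")
      case True
      then have "exp t \<le> exp d + 1" using t(1) by (simp add: add_increasing2)
      then have "exp t / 2 * d\<^sup>2 \<le> (exp d + 1) / 2 * d\<^sup>2" by (intro mult_right_mono) auto
      moreover have "exp t / 2 * d\<^sup>2 = exp d - 1 - d" using t(2) by (simp add: numeral_2_eq_2)
      ultimately show ?thesis by (simp add: mult.commute)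
    next
      case False
      obtain t where "exp d = (\<Sum>m<3. d ^ m / fact m) + exp t / fact 3 * d ^ 3"
        using Maclaurin_exp_le[of d 3] by blast
      moreover have "exp t / fact 3 * d ^ 3 \<le> 0"
        using False by (intro mult_nonneg_nonpos) (auto simp: power_le_zero_eq)
      ultimately have "exp d - 1 - d \<le> d\<^sup>2 / 2"
        by (simp add: numeral_3_eq_3 numeral_2_eq_2 mult_ac)
      moreover have "0 \<le> d\<^sup>2 * exp d / 2" by simp
      moreover have "d\<^sup>2 * (exp d + 1) / 2 = d\<^sup>2 / 2 + d\<^sup>2 * exp d / 2" by (simp add: field_simps)
      ultimately show ?thesis by linarith
    qed
    then show ?thesis by simp
  qed
  have "exp b * (exp d - 1 - d) \<le> exp b * (d\<^sup>2 * (exp d + 1) / 2)"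
    by (rule mult_left_mono[OF *]) simp
  moreover have "exp a = exp b * exp d" by (simp add: d_def flip: exp_add)
  ultimately show ?thesis by (simp add: d_def algebra_simps)
qed

section \<open>Traces as double sums over two frames\<close>

context euclidean_jordan_algebra
begin

lemma frame_mult:
  assumes F: "jordan_frame \<J> F"
  shows "(\<Sum>q\<in>F. f q *\<^sub>R q) \<odot> (\<Sum>q\<in>F. g q *\<^sub>R q) = (\<Sum>q\<in>F. (f q * g q) *\<^sub>R q)"
  using orthogonal_mult_sum[OF jordan_frameD(1)[OF F], of _ g] jordan_frameD(5)[OF F]
  by (simp add: mult_sum_left mult_scaleR)

lemma jtrace_frame_frame:
  assumes F: "jordan_frame \<J> F" and G: "jordan_frame \<J> G"
  shows "jtrace \<J> ((\<Sum>q\<in>F. f q *\<^sub>R q) \<odot> (\<Sum>p\<in>G. g p *\<^sub>R p))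
    = (\<Sum>q\<in>F. \<Sum>p\<in>G. f q * g p * jtrace \<J> (q \<odot> p))"
  using jordan_frameD(5)[OF F] jordan_frameD(5)[OF G]
  by (subst sum.swap) (simp add: mult_sum_left mult_sum_right mult_scaleR mult_scaleR_right
      jtrace_sum jtrace_linear sum_distrib_left mult_ac)

lemma jtrace_frame_left:
  assumes F: "jordan_frame \<J> F" and x: "x \<in> J"
  shows "jtrace \<J> ((\<Sum>q\<in>F. f q *\<^sub>R q) \<odot> x) = (\<Sum>q\<in>F. f q * jtrace \<J> (q \<odot> x))"
  using jordan_frameD(5)[OF F] x by (simp add: mult_sum_left mult_scaleR jtrace_sum jtrace_linear)

lemma jtrace_frame_partition:
  assumes F: "jordan_frame \<J> F" and x: "x \<in> J"
  shows "(\<Sum>q\<in>F. jtrace \<J> (q \<odot> x)) = jtrace \<J> x"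
  using jtrace_frame_left[OF F x, of "\<lambda>_. 1"] jordan_frameD(2)[OF F] x by (simp add: unit_mult)

lemma cone_carrier: "x \<in> cone_of_squares \<J> \<Longrightarrow> x \<in> J"
  by (auto simp: cone_of_squares_def)

lemma jtrace_idempotent_cone:
  "idempotent \<J> q \<Longrightarrow> x \<in> cone_of_squares \<J> \<Longrightarrow> 0 \<le> jtrace \<J> (q \<odot> x)"
  using idempotent_mult_psd by (auto simp: cone_of_squares_def)

lemma cone_frame:
  assumes F: "jordan_frame \<J> F" and l: "\<And>q. q \<in> F \<Longrightarrow> 0 \<le> l q"
  shows "(\<Sum>q\<in>F. l q *\<^sub>R q) \<in> cone_of_squares \<J>"
proof -
  have "(\<Sum>q\<in>F. l q *\<^sub>R q) = (\<Sum>q\<in>F. sqrt (l q) *\<^sub>R q) \<odot> (\<Sum>q\<in>F. sqrt (l q) *\<^sub>R q)"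
    unfolding frame_mult[OF F] using l by (intro sum.cong) auto
  then show ?thesis using jordan_frameD(5)[OF F] by (auto simp: cone_of_squares_def)
qed

lemma jtrace_frame_nonneg:
  assumes "jordan_frame \<J> F" "jordan_frame \<J> G" "q \<in> F" "p \<in> G"
  shows "0 \<le> jtrace \<J> (q \<odot> p)"
  using idempotent_mult_psd[OF jordan_frameD(6)[OF assms(1,3)], of p]
    idempotent_simps[OF jordan_frameD(6)[OF assms(2,4)]] by simp

text \<open>The left factor and \<open>z\<close> are diagonal in the same frame \<open>F\<close>, so
  their product is too; associativity of the trace forms this product first, while
  \<open>y \<odot> y\<close> stays diagonal in \<open>G\<close>. Hence only the pair weights Tr(q p)
  occur.\<close>

lemma jtrace_frame_square_diff:
  assumes F: "jordan_frame \<J> F" and G: "jordan_frame \<J> G"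
    and z: "z = (\<Sum>q\<in>F. \<mu> q *\<^sub>R q)" and y: "y = (\<Sum>p\<in>G. \<nu> p *\<^sub>R p)"
  shows "jtrace \<J> ((\<Sum>q\<in>F. f q *\<^sub>R q) \<odot> ((z - y) \<odot> (z - y)))
    = (\<Sum>q\<in>F. \<Sum>p\<in>G. f q * (\<mu> q - \<nu> p)\<^sup>2 * jtrace \<J> (q \<odot> p))"
proof -
  define v where "v = (\<Sum>q\<in>F. f q *\<^sub>R q)"
  have [simp]: "v \<in> J" "z \<in> J" "y \<in> J"
    using jordan_frameD(5)[OF F] jordan_frameD(5)[OF G] by (simp_all add: v_def z y)
  have vz: "v \<odot> z = (\<Sum>q\<in>F. (f q * \<mu> q) *\<^sub>R q)" by (simp add: v_def z frame_mult[OF F])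
  have yy: "y \<odot> y = (\<Sum>p\<in>G. (\<nu> p * \<nu> p) *\<^sub>R p)" by (simp add: y frame_mult[OF G])
  have 1: "jtrace \<J> (v \<odot> (z \<odot> z)) = (\<Sum>q\<in>F. \<Sum>p\<in>G. f q * (\<mu> q)\<^sup>2 * jtrace \<J> (q \<odot> p))"
  proof -
    have "jtrace \<J> (v \<odot> (z \<odot> z)) = jtrace \<J> ((v \<odot> z) \<odot> z)" by (simp add: jtrace_assoc)
    also have "\<dots> = jtrace \<J> ((\<Sum>q\<in>F. (f q * (\<mu> q)\<^sup>2) *\<^sub>R q) \<odot> (\<Sum>p\<in>G. 1 *\<^sub>R p))"
      unfolding vz unfolding z frame_mult[OF F] using jordan_frameD(2)[OF G] jordan_frameD(5)[OF F]
      by (simp add: power2_eq_square mult.assoc)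
    also have "\<dots> = (\<Sum>q\<in>F. \<Sum>p\<in>G. f q * (\<mu> q)\<^sup>2 * jtrace \<J> (q \<odot> p))"
      unfolding jtrace_frame_frame[OF F G] by simp
    finally show ?thesis .
  qed
  have 2: "jtrace \<J> (v \<odot> (z \<odot> y)) = (\<Sum>q\<in>F. \<Sum>p\<in>G. f q * \<mu> q * \<nu> p * jtrace \<J> (q \<odot> p))"
  proof -
    have "jtrace \<J> (v \<odot> (z \<odot> y)) = jtrace \<J> ((v \<odot> z) \<odot> y)" by (simp add: jtrace_assoc)
    then show ?thesis unfolding vz unfolding y jtrace_frame_frame[OF F G] by simp
  qed
  have 3: "jtrace \<J> (v \<odot> (y \<odot> y)) = (\<Sum>q\<in>F. \<Sum>p\<in>G. f q * (\<nu> p * \<nu> p) * jtrace \<J> (q \<odot> p))"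
    unfolding yy v_def jtrace_frame_frame[OF F G] ..
  have "(z - y) \<odot> (z - y) = z \<odot> z - 2 *\<^sub>R (z \<odot> y) + y \<odot> y"
    using mult_commute[of y z] by (simp add: mult_distribs scaleR_2)
  then have "jtrace \<J> (v \<odot> ((z - y) \<odot> (z - y)))
      = jtrace \<J> (v \<odot> (z \<odot> z)) - 2 * jtrace \<J> (v \<odot> (z \<odot> y)) + jtrace \<J> (v \<odot> (y \<odot> y))"
    by (simp add: mult_add_right mult_diff_right mult_scaleR_right jtrace_linear)
  also have "\<dots> = (\<Sum>q\<in>F. \<Sum>p\<in>G. f q * (\<mu> q - \<nu> p)\<^sup>2 * jtrace \<J> (q \<odot> p))"
    unfolding 1 2 3
    by (simp add: sum_distrib_left power2_eq_square algebra_simps flip: sum.distrib sum_subtractf)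
  finally show ?thesis by (simp add: v_def)
qed

lemma jtrace_exp_second_order:
  assumes F: "jordan_frame \<J> F" and G: "jordan_frame \<J> G"
    and z: "z = (\<Sum>q\<in>F. \<mu> q *\<^sub>R q)" and y: "y = (\<Sum>p\<in>G. \<nu> p *\<^sub>R p)"
    and ez: "ez = (\<Sum>q\<in>F. exp (\<mu> q) *\<^sub>R q)" and ey: "ey = (\<Sum>p\<in>G. exp (\<nu> p) *\<^sub>R p)"
  shows "jtrace \<J> ez - jtrace \<J> ey - jtrace \<J> (ey \<odot> (z - y))
    \<le> (jtrace \<J> (ez \<odot> ((z - y) \<odot> (z - y))) + jtrace \<J> (ey \<odot> ((z - y) \<odot> (z - y)))) / 2"
proof -
  have [simp]: "ey \<in> J" "ez \<in> J" "z \<in> J" "y \<in> J"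
    using jordan_frameD(5)[OF F] jordan_frameD(5)[OF G] by (simp_all add: z y ey ez)
  define w where "w q p = jtrace \<J> (q \<odot> p)" for q p
  have w0: "0 \<le> w q p" if "q \<in> F" "p \<in> G" for q p
    using jtrace_frame_nonneg[OF F G that] by (simp add: w_def)
  have eF: "\<e> = (\<Sum>q\<in>F. 1 *\<^sub>R q)" and eG: "\<e> = (\<Sum>p\<in>G. 1 *\<^sub>R p)"
    using jordan_frameD(2)[OF F] jordan_frameD(2)[OF G] by simp_all
  have com: "ey \<odot> a = a \<odot> ey" if "a \<in> J" for a using mult_commute that by simp
  have 1: "jtrace \<J> ez = (\<Sum>q\<in>F. \<Sum>p\<in>G. exp (\<mu> q) * 1 * w q p)"
    unfolding w_def jtrace_frame_frame[OF F G, symmetric] eG[symmetric] ez[symmetric] by simp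
  have 2: "jtrace \<J> ey = (\<Sum>q\<in>F. \<Sum>p\<in>G. 1 * exp (\<nu> p) * w q p)"
    unfolding w_def jtrace_frame_frame[OF F G, symmetric] eF[symmetric] ey[symmetric]
    by (simp add: unit_mult)
  have 3: "jtrace \<J> (ey \<odot> z) = (\<Sum>q\<in>F. \<Sum>p\<in>G. \<mu> q * exp (\<nu> p) * w q p)"
    unfolding w_def jtrace_frame_frame[OF F G, symmetric] z[symmetric] ey[symmetric]
    by (simp add: com)
  have "ey \<odot> y = (\<Sum>p\<in>G. (exp (\<nu> p) * \<nu> p) *\<^sub>R p)" by (simp add: ey y frame_mult[OF G])
  then have 4: "jtrace \<J> (ey \<odot> y) = (\<Sum>q\<in>F. \<Sum>p\<in>G. 1 * (exp (\<nu> p) * \<nu> p) * w q p)"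
    unfolding w_def jtrace_frame_frame[OF F G, symmetric] eF[symmetric]
    using \<open>ey \<in> J\<close> \<open>y \<in> J\<close> by (metis unit_mult mult_closed)
  have 5: "jtrace \<J> (ez \<odot> ((z - y) \<odot> (z - y))) = (\<Sum>q\<in>F. \<Sum>p\<in>G. exp (\<mu> q) * (\<mu> q - \<nu> p)\<^sup>2 * w q p)"
    unfolding ez w_def by (rule jtrace_frame_square_diff[OF F G z y])
  \<comment> \<open>\<open>ey\<close> is diagonal in \<open>G\<close>, so the double-sum formula is
    applied with the two frames exchanged.\<close>
  have "(z - y) \<odot> (z - y) = (y - z) \<odot> (y - z)"
    using mult_minus_left[of "y - z" "y - z"] mult_minus_right[of "- (y - z)" "y - z"] by simp
  then have "jtrace \<J> (ey \<odot> ((z - y) \<odot> (z - y)))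
      = (\<Sum>p\<in>G. \<Sum>q\<in>F. exp (\<nu> p) * (\<nu> p - \<mu> q)\<^sup>2 * jtrace \<J> (p \<odot> q))"
    unfolding ey by (simp only: jtrace_frame_square_diff[OF G F y z])
  also have "\<dots> = (\<Sum>q\<in>F. \<Sum>p\<in>G. exp (\<nu> p) * (\<mu> q - \<nu> p)\<^sup>2 * w q p)"
    using mult_commute jordan_frameD(5)[OF F] jordan_frameD(5)[OF G]
    by (subst sum.swap) (auto intro!: sum.cong simp: w_def power2_commute)
  finally have 6: "jtrace \<J> (ey \<odot> ((z - y) \<odot> (z - y)))
    = (\<Sum>q\<in>F. \<Sum>p\<in>G. exp (\<nu> p) * (\<mu> q - \<nu> p)\<^sup>2 * w q p)" .
  have "jtrace \<J> ez - jtrace \<J> ey - jtrace \<J> (ey \<odot> (z - y))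
      = (\<Sum>q\<in>F. \<Sum>p\<in>G. (exp (\<mu> q) - exp (\<nu> p) - exp (\<nu> p) * (\<mu> q - \<nu> p)) * w q p)"
    by (simp add: mult_diff_right jtrace_linear 1 2 3 4 algebra_simps flip: sum_subtractf sum.distrib)
  also have "\<dots> \<le> (\<Sum>q\<in>F. \<Sum>p\<in>G. ((\<mu> q - \<nu> p)\<^sup>2 * (exp (\<mu> q) + exp (\<nu> p)) / 2) * w q p)"
    by (intro sum_mono mult_right_mono exp_taylor_bound w0)
  also have "\<dots> = (jtrace \<J> (ez \<odot> ((z - y) \<odot> (z - y))) + jtrace \<J> (ey \<odot> ((z - y) \<odot> (z - y)))) / 2"
    unfolding 5 6 by (simp add: sum_divide_distrib add_divide_distrib algebra_simps flip: sum.distrib)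
  finally show ?thesis .
qed

lemma spectral_frame_jordan:
  assumes "x \<in> J"
  shows "jordan_frame \<J> (spectral_frame \<J> x)"
    and "x = (\<Sum>q\<in>spectral_frame \<J> x. eigenvalue \<J> x q *\<^sub>R q)"
  using spectral_decomposition_choice[OF assms] unfolding spectral_decomposition_def by blast+

lemma jexp_carrier: "x \<in> J \<Longrightarrow> jexp \<J> x \<in> J"
  using jordan_frameD(5)[OF spectral_frame_jordan(1)] by (auto simp: jexp_def)

lemma jexp_cone: "x \<in> J \<Longrightarrow> jexp \<J> x \<in> cone_of_squares \<J>"
  unfolding jexp_def by (rule cone_frame[OF spectral_frame_jordan(1)]) auto

lemma jtrace_jexp: "x \<in> J \<Longrightarrow> jtrace \<J> (jexp \<J> x) = (\<Sum>q\<in>spectral_frame \<J> x. exp (eigenvalue \<J> x q))"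
  unfolding jexp_def by (rule jtrace_frame[OF spectral_frame_jordan(1)])

lemma jordan_frame_nonempty: "jordan_frame \<J> F \<Longrightarrow> 0 < jrank \<J> \<Longrightarrow> F \<noteq> {}"
  using card_jordan_frame by fastforce

lemma jtrace_jexp_pos: "x \<in> J \<Longrightarrow> 0 < jrank \<J> \<Longrightarrow> 0 < jtrace \<J> (jexp \<J> x)"
  using jordan_frame_nonempty[OF spectral_frame_jordan(1)] jordan_frameD(4)[OF spectral_frame_jordan(1)]
  by (simp add: jtrace_jexp sum_pos)

lemma jexp_0: "jexp \<J> 0 = \<e>"
proof -
  note F = spectral_frame_jordan[of 0, simplified]
  have "eigenvalue \<J> 0 q = 0" if "q \<in> spectral_frame \<J> 0" for q
    using orthogonal_mult_sum[OF jordan_frameD(1)[OF F(1)] that, of "eigenvalue \<J> 0"] F(2)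
      orthogonal_idempotentsD(3,4)[OF jordan_frameD(1)[OF F(1)] that] by simp
  then show ?thesis using jordan_frameD(2)[OF F(1)] by (simp add: jexp_def)
qed

lemma eigenvalue_le_spectral_norm:
  assumes "x \<in> J" "q \<in> spectral_frame \<J> x"
  shows "\<bar>eigenvalue \<J> x q\<bar> \<le> spectral_norm \<J> x"
  unfolding spectral_norm_def
  using assms jordan_frameD(4)[OF spectral_frame_jordan(1)[OF assms(1)]] by (intro Max_ge) auto

lemma jtrace_cone_nonneg:
  assumes "v \<in> cone_of_squares \<J>" shows "0 \<le> jtrace \<J> v"
  using assms jtrace_square_nonneg by (auto simp: cone_of_squares_def)

text \<open>In the eigenframe of \<open>a\<close> both traces are sums of eigenvalues or their
  squares with nonnegative weights Tr(q v) of total Tr(v).\<close>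

lemma jtrace_spectral_norm:
  assumes a: "a \<in> J" and v: "v \<in> cone_of_squares \<J>"
  shows "\<bar>jtrace \<J> (a \<odot> v)\<bar> \<le> spectral_norm \<J> a * jtrace \<J> v"
    and "jtrace \<J> ((a \<odot> a) \<odot> v) \<le> (spectral_norm \<J> a)\<^sup>2 * jtrace \<J> v"
proof -
  define F l where "F = spectral_frame \<J> a" and "l = eigenvalue \<J> a"
  have F: "jordan_frame \<J> F" "a = (\<Sum>q\<in>F. l q *\<^sub>R q)"
    using spectral_frame_jordan[OF a] by (simp_all add: F_def l_def)
  have l: "\<bar>l q\<bar> \<le> spectral_norm \<J> a" if "q \<in> F" for q
    using eigenvalue_le_spectral_norm[OF a] that by (simp add: F_def l_def)
  note vJ = cone_carrier[OF v]
  have t: "0 \<le> jtrace \<J> (q \<odot> v)" if "q \<in> F" for q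
    using jtrace_idempotent_cone[OF jordan_frameD(6)[OF F(1) that] v] .
  have "\<bar>jtrace \<J> (a \<odot> v)\<bar> \<le> (\<Sum>q\<in>F. \<bar>l q * jtrace \<J> (q \<odot> v)\<bar>)"
    unfolding F(2) jtrace_frame_left[OF F(1) vJ] by (rule sum_abs)
  also have "\<dots> \<le> (\<Sum>q\<in>F. spectral_norm \<J> a * jtrace \<J> (q \<odot> v))"
    using l t by (intro sum_mono) (simp add: abs_mult mult_right_mono)
  finally show "\<bar>jtrace \<J> (a \<odot> v)\<bar> \<le> spectral_norm \<J> a * jtrace \<J> v"
    by (simp add: jtrace_frame_partition[OF F(1) vJ] flip: sum_distrib_left)
  have "jtrace \<J> ((a \<odot> a) \<odot> v) = (\<Sum>q\<in>F. (l q * l q) * jtrace \<J> (q \<odot> v))"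
    unfolding F(2) frame_mult[OF F(1)] jtrace_frame_left[OF F(1) vJ] ..
  also have "\<dots> \<le> (\<Sum>q\<in>F. (spectral_norm \<J> a)\<^sup>2 * jtrace \<J> (q \<odot> v))"
    using l t power_mono[of "\<bar>l _\<bar>" "spectral_norm \<J> a" 2]
    by (intro sum_mono mult_right_mono) (auto simp: power2_eq_square)
  finally show "jtrace \<J> ((a \<odot> a) \<odot> v) \<le> (spectral_norm \<J> a)\<^sup>2 * jtrace \<J> v"
    by (simp add: jtrace_frame_partition[OF F(1) vJ] flip: sum_distrib_left)
qed

text \<open>The symmetric Taylor bound leaves the potential after the step on the right-hand side as
  well; \<open>mw_potential\<close> absorbs it into the exponent.\<close>

lemma jtrace_jexp_step:
  assumes y: "y \<in> J" and a: "a \<in> J" and \<rho>: "spectral_norm \<J> a \<le> \<rho>" "0 \<le> spectral_norm \<J> a"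
  shows "jtrace \<J> (jexp \<J> (y - c *\<^sub>R a)) - jtrace \<J> (jexp \<J> y) + c * jtrace \<J> (a \<odot> jexp \<J> y)
    \<le> (c * \<rho>)\<^sup>2 / 2 * (jtrace \<J> (jexp \<J> (y - c *\<^sub>R a)) + jtrace \<J> (jexp \<J> y))"
proof -
  define z where "z = y - c *\<^sub>R a"
  have zJ [simp]: "z \<in> J" using y a by (simp add: z_def)
  have h: "z - y = (- c) *\<^sub>R a" by (simp add: z_def)
  note [simp] = y a jexp_carrier[OF y] jexp_carrier[OF zJ]
  have hh: "(z - y) \<odot> (z - y) = c\<^sup>2 *\<^sub>R (a \<odot> a)"
    unfolding h by (simp add: mult_distribs power2_eq_square)
  have sq: "jtrace \<J> (v \<odot> ((z - y) \<odot> (z - y))) \<le> (c * \<rho>)\<^sup>2 * jtrace \<J> v" if "v \<in> cone_of_squares \<J>" for v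
  proof -
    have [simp]: "v \<in> J" using cone_carrier[OF that] .
    have "jtrace \<J> (v \<odot> ((z - y) \<odot> (z - y))) = c\<^sup>2 * jtrace \<J> ((a \<odot> a) \<odot> v)"
      using mult_commute[of v "a \<odot> a"] by (simp add: hh mult_scaleR_right jtrace_linear)
    also have "\<dots> \<le> c\<^sup>2 * ((spectral_norm \<J> a)\<^sup>2 * jtrace \<J> v)"
      by (intro mult_left_mono jtrace_spectral_norm that) auto
    also have "\<dots> \<le> c\<^sup>2 * (\<rho>\<^sup>2 * jtrace \<J> v)"
      using \<rho> jtrace_cone_nonneg[OF that] by (intro mult_left_mono mult_right_mono power_mono) auto
    finally show ?thesis by (simp add: power_mult_distrib)
  qed
  have "jtrace \<J> (jexp \<J> z) - jtrace \<J> (jexp \<J> y) - jtrace \<J> (jexp \<J> y \<odot> (z - y))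
    \<le> (jtrace \<J> (jexp \<J> z \<odot> ((z - y) \<odot> (z - y))) + jtrace \<J> (jexp \<J> y \<odot> ((z - y) \<odot> (z - y)))) / 2"
    by (rule jtrace_exp_second_order[OF spectral_frame_jordan(1)[OF zJ] spectral_frame_jordan(1)[OF y]
      spectral_frame_jordan(2)[OF zJ] spectral_frame_jordan(2)[OF y]]) (simp_all add: jexp_def)
  also have "\<dots> \<le> ((c * \<rho>)\<^sup>2 * jtrace \<J> (jexp \<J> z) + (c * \<rho>)\<^sup>2 * jtrace \<J> (jexp \<J> y)) / 2"
    by (intro divide_right_mono add_mono sq jexp_cone) auto
  also have "jtrace \<J> (jexp \<J> y \<odot> (z - y)) = - c * jtrace \<J> (a \<odot> jexp \<J> y)"
    using mult_commute[of "jexp \<J> y" a] unfolding h by (simp add: mult_minus_right mult_scaleR_right jtrace_linear)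
  finally show ?thesis by (simp add: z_def algebra_simps)
qed

text \<open>The exponent is a convex combination of the eigenvalues of \<open>y\<close>, hence at
  most the largest one, whose exponential is a summand of the right-hand side.\<close>

lemma exp_jtrace_le_jtrace_jexp:
  assumes y: "y \<in> J" and x: "x \<in> cone_of_squares \<J>" "jtrace \<J> x = 1"
  shows "exp (jtrace \<J> (y \<odot> x)) \<le> jtrace \<J> (jexp \<J> y)"
proof -
  define F l where "F = spectral_frame \<J> y" and "l = eigenvalue \<J> y"
  have F: "jordan_frame \<J> F" "y = (\<Sum>q\<in>F. l q *\<^sub>R q)"
    using spectral_frame_jordan[OF y] by (simp_all add: F_def l_def)
  note xJ = cone_carrier[OF x(1)]
  have fin: "finite F" using jordan_frameD(4)[OF F(1)] .
  have t: "0 \<le> jtrace \<J> (q \<odot> x)" if "q \<in> F" for q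
    using jtrace_idempotent_cone[OF jordan_frameD(6)[OF F(1) that] x(1)] .
  have t1: "(\<Sum>q\<in>F. jtrace \<J> (q \<odot> x)) = 1" using jtrace_frame_partition[OF F(1) xJ] x(2) by simp
  then have "F \<noteq> {}" by auto
  then have M: "Max (l ` F) \<in> l ` F" using fin by simp
  then obtain q0 where q0: "q0 \<in> F" "Max (l ` F) = l q0" by blast
  have "jtrace \<J> (y \<odot> x) = (\<Sum>q\<in>F. l q * jtrace \<J> (q \<odot> x))"
    unfolding F(2) jtrace_frame_left[OF F(1) xJ] ..
  also have "\<dots> \<le> (\<Sum>q\<in>F. l q0 * jtrace \<J> (q \<odot> x))"
    using t fin by (intro sum_mono mult_right_mono) (auto simp flip: q0(2))
  also have "\<dots> = l q0" using t1 by (simp flip: sum_distrib_left)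
  finally have "exp (jtrace \<J> (y \<odot> x)) \<le> exp (l q0)" by simp
  also have "\<dots> \<le> (\<Sum>q\<in>F. exp (l q))" using q0(1) fin by (intro member_le_sum) auto
  also have "\<dots> = jtrace \<J> (jexp \<J> y)" using jtrace_jexp[OF y] by (simp add: F_def l_def)
  finally show ?thesis .
qed

lemma jtrace_frame_element:
  assumes F: "jordan_frame \<J> F" and q: "q \<in> F"
  shows "jtrace \<J> q = 1"
proof -
  define l :: "'v \<Rightarrow> real" where "l p = (if p = q then 1 else 0)" for p
  have "(\<Sum>p\<in>F. l p *\<^sub>R p) = (\<Sum>p\<in>F. if p = q then p else 0)"
    by (intro sum.cong) (auto simp: l_def)
  also have "\<dots> = q" using jordan_frameD(4)[OF F] q by simp
  finally have "jtrace \<J> q = (\<Sum>p\<in>F. l p)"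
    using jtrace_frame[OF F, of l] by simp
  then show ?thesis using jordan_frameD(4)[OF F] q by (simp add: l_def)
qed

text \<open>A sum of squares is not visibly a square, but nonnegativity against all idempotents is a
  linear condition, from which closure under sums is immediate. For the converse it is tested on an
  eigenframe.\<close>

lemma cone_of_squares_iff:
  "x \<in> cone_of_squares \<J> \<longleftrightarrow> x \<in> J \<and> (\<forall>q. idempotent \<J> q \<longrightarrow> 0 \<le> jtrace \<J> (q \<odot> x))"
proof (intro iffI conjI allI impI; (elim conjE)?)
  assume x: "x \<in> J" and pos: "\<forall>q. idempotent \<J> q \<longrightarrow> 0 \<le> jtrace \<J> (q \<odot> x)"
  obtain F l where F: "jordan_frame \<J> F" and xF: "x = (\<Sum>q\<in>F. l q *\<^sub>R q)"
    using x by (rule spectral_frame_exists)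
  have "0 \<le> l q" if "q \<in> F" for q
  proof -
    have "0 \<le> jtrace \<J> (q \<odot> x)" using pos jordan_frameD(6)[OF F that] by blast
    also have "q \<odot> x = l q *\<^sub>R q"
      unfolding xF by (rule orthogonal_mult_sum[OF jordan_frameD(1)[OF F] that])
    finally show ?thesis
      using jordan_frameD(5)[OF F that] by (simp add: jtrace_linear jtrace_frame_element[OF F that])
  qed
  then show "x \<in> cone_of_squares \<J>" unfolding xF by (rule cone_frame[OF F])
qed (auto intro: cone_carrier jtrace_idempotent_cone)

lemma cone_scale: "x \<in> cone_of_squares \<J> \<Longrightarrow> 0 \<le> c \<Longrightarrow> c *\<^sub>R x \<in> cone_of_squares \<J>"
  by (auto simp: cone_of_squares_iff mult_scaleR_right jtrace_linear idempotent_def)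

lemma cone_sum: "(\<And>i. i \<in> A \<Longrightarrow> f i \<in> cone_of_squares \<J>) \<Longrightarrow> sum f A \<in> cone_of_squares \<J>"
  by (auto simp: cone_of_squares_iff mult_sum_right jtrace_sum idempotent_def intro!: sum_nonneg)

lemma trace_inner_linear:
  "x \<in> J \<Longrightarrow> y \<in> J \<Longrightarrow> trace_inner \<J> x (c *\<^sub>R y) = c * trace_inner \<J> x y"
  "x \<in> J \<Longrightarrow> (\<And>i. i \<in> A \<Longrightarrow> f i \<in> J) \<Longrightarrow> trace_inner \<J> x (sum f A) = (\<Sum>i\<in>A. trace_inner \<J> x (f i))"
  by (simp_all add: trace_inner_def mult_scaleR_right jtrace_linear mult_sum_right jtrace_sum)

lemma spectral_norm_nonneg:
  assumes "x \<in> J" "0 < jrank \<J>"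
  shows "0 \<le> spectral_norm \<J> x"
proof -
  obtain q where "q \<in> spectral_frame \<J> x"
    using jordan_frame_nonempty[OF spectral_frame_jordan(1)] assms by blast
  then show ?thesis using eigenvalue_le_spectral_norm[OF assms(1)] abs_ge_zero order_trans by blast
qed

section \<open>Potential and regret of the iterates\<close>

definition mw_dual :: "(nat \<Rightarrow> 'v) \<Rightarrow> real \<Rightarrow> real \<Rightarrow> nat list \<Rightarrow> 'v" where
  "mw_dual a \<rho> \<eta> ps = - (\<eta> *\<^sub>R (\<Sum>p\<leftarrow>ps. (1 / \<rho>) *\<^sub>R a p))"

text \<open>The exponential of 0 is the unit, with trace equal to the rank, so the separately
  specified starting point fits the general formula.\<close>

lemma mw_iterate_eq:
  "mw_iterate \<J> a \<rho> \<eta> ps =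
    (1 / jtrace \<J> (jexp \<J> (mw_dual a \<rho> \<eta> ps))) *\<^sub>R jexp \<J> (mw_dual a \<rho> \<eta> ps)"
  by (simp add: mw_iterate_def mw_dual_def Let_def jexp_0 jtrace_unit)

lemma mw_dual_snoc: "mw_dual a \<rho> \<eta> (ps @ [p]) = mw_dual a \<rho> \<eta> ps - (\<eta> / \<rho>) *\<^sub>R a p"
  by (simp add: mw_dual_def scaleR_add_right)

lemma mw_dual_carrier: "(\<And>p. p \<in> set ps \<Longrightarrow> a p \<in> J) \<Longrightarrow> mw_dual a \<rho> \<eta> ps \<in> J"
  by (induction ps rule: rev_induct) (auto simp: mw_dual_snoc, simp add: mw_dual_def)

lemma mw_iterate_density:
  assumes "\<And>p. p \<in> set ps \<Longrightarrow> a p \<in> J" "0 < jrank \<J>"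
  shows "mw_iterate \<J> a \<rho> \<eta> ps \<in> cone_of_squares \<J>" "jtrace \<J> (mw_iterate \<J> a \<rho> \<eta> ps) = 1"
proof -
  define y where "y = mw_dual a \<rho> \<eta> ps"
  have y: "y \<in> J" using assms by (simp add: y_def mw_dual_carrier)
  have W: "0 < jtrace \<J> (jexp \<J> y)" by (rule jtrace_jexp_pos[OF y assms(2)])
  show "mw_iterate \<J> a \<rho> \<eta> ps \<in> cone_of_squares \<J>" "jtrace \<J> (mw_iterate \<J> a \<rho> \<eta> ps) = 1"
    unfolding mw_iterate_eq y_def[symmetric] using W y
    by (auto intro!: cone_scale jexp_cone simp: jtrace_linear jexp_carrier)
qed

lemma mw_potential:
  assumes a: "\<And>p. p \<in> set ps \<Longrightarrow> a p \<in> J \<and> spectral_norm \<J> (a p) \<le> \<rho>"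
    and r: "0 < jrank \<J>" and \<rho>: "0 < \<rho>" and \<eta>: "0 \<le> \<eta>" "\<eta> \<le> 1 / 2"
  shows "jtrace \<J> (jexp \<J> (mw_dual a \<rho> \<eta> ps)) \<le> real (jrank \<J>) *
    exp (\<Sum>k<length ps. 2 * \<eta>\<^sup>2 - \<eta> / \<rho> * trace_inner \<J> (a (ps ! k)) (mw_iterate \<J> a \<rho> \<eta> (take k ps)))"
  using a
proof (induction ps rule: rev_induct)
  case Nil
  then show ?case by (simp add: mw_dual_def jexp_0 jtrace_unit)
next
  case (snoc p ps)
  define y where "y = mw_dual a \<rho> \<eta> ps"
  define Wy Wz where "Wy = jtrace \<J> (jexp \<J> y)" and "Wz = jtrace \<J> (jexp \<J> (y - (\<eta> / \<rho>) *\<^sub>R a p))"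
  define t where "t = trace_inner \<J> (a p) (mw_iterate \<J> a \<rho> \<eta> ps)"
  have y: "y \<in> J" and ap: "a p \<in> J" "spectral_norm \<J> (a p) \<le> \<rho>"
    using snoc.prems by (auto simp: y_def mw_dual_carrier)
  have W: "0 < Wy" "0 < Wz" using y ap r by (auto simp: Wy_def Wz_def intro!: jtrace_jexp_pos)
  have t: "jtrace \<J> (a p \<odot> jexp \<J> y) = t * Wy"
    using W y ap by (simp add: t_def mw_iterate_eq trace_inner_linear jexp_carrier Wy_def flip: y_def)
      (simp add: trace_inner_def)
  \<comment> \<open>The factor (c \<rho>)^2 / 2 of the step inequality at c = \<eta> /
    \<rho>.\<close>
  define u where "u = \<eta>\<^sup>2 / 2"
  have "\<eta>\<^sup>2 \<le> (1 / 2)\<^sup>2" using \<eta> by (intro power_mono) auto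
  then have u: "0 \<le> u" "u \<le> 1 / 8" by (simp_all add: u_def power2_eq_square)
  have "Wz - Wy + \<eta> / \<rho> * (t * Wy) \<le> u * (Wz + Wy)"
    using jtrace_jexp_step[OF y ap spectral_norm_nonneg[OF ap(1) r], of "\<eta> / \<rho>"] \<rho>
    by (simp add: t Wy_def Wz_def u_def)
  then have "Wz * (1 - u) \<le> Wy * (1 + (u - \<eta> / \<rho> * t))" by (simp add: algebra_simps)
  also have "\<dots> \<le> Wy * exp (u - \<eta> / \<rho> * t)" using W by (intro mult_left_mono exp_ge_add_one_self) auto
  finally have "Wz * (1 - u) * exp (2 * u) \<le> Wy * exp (u - \<eta> / \<rho> * t) * exp (2 * u)"
    by (intro mult_right_mono) auto
  \<comment> \<open>This removes the new potential from the error term, at the cost of a factor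
    exp(2u).\<close>
  moreover have "1 \<le> (1 - u) * exp (2 * u)"
  proof -
    have "0 \<le> u * (1 - 2 * u)" using u by (intro mult_nonneg_nonneg) auto
    then have "1 \<le> (1 - u) * (1 + 2 * u)" by (simp add: algebra_simps)
    also have "\<dots> \<le> (1 - u) * exp (2 * u)" using u by (intro mult_left_mono exp_ge_add_one_self) auto
    finally show ?thesis .
  qed
  then have "Wz * 1 \<le> Wz * ((1 - u) * exp (2 * u))" using W by (intro mult_left_mono) auto
  ultimately have "Wz \<le> Wy * exp (u - \<eta> / \<rho> * t) * exp (2 * u)"
    by (metis (no_types) mult.assoc mult_1_right order_trans)
  also have "\<dots> = Wy * exp (3 * u - \<eta> / \<rho> * t)" by (simp add: algebra_simps flip: exp_add)
  \<comment> \<open>3u is (3/2) \<eta>^2, rounded up to 2 \<eta>^2.\<close>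
  also have "\<dots> \<le> Wy * exp (2 * \<eta>\<^sup>2 - \<eta> / \<rho> * t)"
    using W by (intro mult_left_mono) (auto simp: u_def)
  also have "\<dots> \<le> real (jrank \<J>) *
    exp (\<Sum>k<length ps. 2 * \<eta>\<^sup>2 - \<eta> / \<rho> * trace_inner \<J> (a (ps ! k)) (mw_iterate \<J> a \<rho> \<eta> (take k ps)))
      * exp (2 * \<eta>\<^sup>2 - \<eta> / \<rho> * t)"
    using snoc.IH snoc.prems unfolding Wy_def y_def by (intro mult_right_mono) auto
  also have "\<dots> = real (jrank \<J>) * exp (\<Sum>k<length (ps @ [p]). 2 * \<eta>\<^sup>2 - \<eta> / \<rho> *
      trace_inner \<J> (a ((ps @ [p]) ! k)) (mw_iterate \<J> a \<rho> \<eta> (take k (ps @ [p]))))"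
    by (simp add: t_def nth_append exp_add)
  finally show ?case by (simp add: Wz_def y_def mw_dual_snoc)
qed

text \<open>The final potential lies above the exponential of the dual sum paired with
  \<open>x\<close> and below the bound accumulated over the rounds; compare logarithms.\<close>

lemma mw_regret:
  assumes a: "\<And>p. p \<in> set ps \<Longrightarrow> a p \<in> J \<and> spectral_norm \<J> (a p) \<le> \<rho>"
    and r: "0 < jrank \<J>" and \<rho>: "0 < \<rho>" and \<eta>: "0 \<le> \<eta>" "\<eta> \<le> 1 / 2"
    and x: "x \<in> cone_of_squares \<J>" "jtrace \<J> x = 1"
  shows "\<eta> / \<rho> * (\<Sum>k<length ps. trace_inner \<J> (a (ps ! k)) (mw_iterate \<J> a \<rho> \<eta> (take k ps))
      - trace_inner \<J> (a (ps ! k)) x) \<le> ln (real (jrank \<J>)) + 2 * \<eta>\<^sup>2 * length ps"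
proof -
  have aJ: "\<And>p. p \<in> set ps \<Longrightarrow> a p \<in> J" using a by blast
  have dual: "jtrace \<J> (mw_dual a \<rho> \<eta> ps \<odot> x) = - (\<eta> / \<rho>) * (\<Sum>k<length ps. trace_inner \<J> (a (ps ! k)) x)"
    using aJ
  proof (induction ps rule: rev_induct)
    case Nil
    then show ?case using cone_carrier[OF x(1)] by (simp add: mw_dual_def jtrace_linear)
  next
    case (snoc p ps)
    then show ?case using cone_carrier[OF x(1)]
      by (simp add: mw_dual_snoc mult_distribs mw_dual_carrier jtrace_linear nth_append
          trace_inner_def algebra_simps)
  qed
  have "exp (- (\<eta> / \<rho>) * (\<Sum>k<length ps. trace_inner \<J> (a (ps ! k)) x))
      \<le> jtrace \<J> (jexp \<J> (mw_dual a \<rho> \<eta> ps))"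
    unfolding dual[symmetric] by (rule exp_jtrace_le_jtrace_jexp[OF mw_dual_carrier[OF aJ] x])
  also have "\<dots> \<le> real (jrank \<J>) * exp (\<Sum>k<length ps. 2 * \<eta>\<^sup>2 - \<eta> / \<rho> *
      trace_inner \<J> (a (ps ! k)) (mw_iterate \<J> a \<rho> \<eta> (take k ps)))" (is "_ \<le> ?W")
    by (rule mw_potential[OF a r \<rho> \<eta>])
  finally have "ln (exp (- (\<eta> / \<rho>) * (\<Sum>k<length ps. trace_inner \<J> (a (ps ! k)) x))) \<le> ln ?W"
    by (intro ln_mono) (use r in auto)
  then show ?thesis
    using r by (simp add: ln_mult sum_subtractf sum_distrib_left sum_negf algebra_simps)
qed

end

section \<open>Adaptive sampling with the exponential mechanism\<close>

lemma pmf_exp_mechanism: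
  assumes "1 \<le> m"
  shows "pmf (exp_mechanism m \<epsilon> \<Delta> Q) i = (if i < m
     then exp (\<epsilon> / (2 * \<Delta>) * Q i) / (\<Sum>j<m. exp (\<epsilon> / (2 * \<Delta>) * Q j)) else 0)"
proof -
  let ?w = "\<lambda>i. exp (\<epsilon> / (2 * \<Delta>) * Q i)"
  let ?Z = "\<Sum>j<m. ?w j"
  have Z: "0 < ?Z" using assms by (intro sum_pos) (auto simp: lessThan_empty_iff)
  let ?f = "\<lambda>i. if i < m then ?w i / ?Z else 0"
  have "(\<integral>\<^sup>+ i. ennreal (?f i) \<partial>count_space UNIV) = (\<Sum>i<m. ennreal (?f i))"
    by (subst nn_integral_count_space'[of "{..<m}"]) (auto split: if_splits)
  also have "\<dots> = ennreal (\<Sum>i<m. ?w i / ?Z)"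
    using Z by (subst sum_ennreal[symmetric]) auto
  also have "\<dots> = 1" using Z by (simp flip: sum_divide_distrib)
  finally show ?thesis
    unfolding exp_mechanism_def by (subst pmf_embed_pmf) (use Z in auto)
qed

lemma set_pmf_exp_mechanism:
  assumes "1 \<le> m" shows "set_pmf (exp_mechanism m \<epsilon> \<Delta> Q) = {..<m}"
proof -
  have "0 < (\<Sum>j<m. exp (\<epsilon> / (2 * \<Delta>) * Q j))"
    using assms by (intro sum_pos) (auto simp: lessThan_empty_iff)
  then show ?thesis by (auto simp: set_pmf_eq pmf_exp_mechanism[OF assms])
qed

section \<open>Adaptive transcripts of an arbitrary kernel\<close>

primrec transcript :: "('b list \<Rightarrow> 'b pmf) \<Rightarrow> nat \<Rightarrow> 'b list pmf" where
  "transcript K 0 = return_pmf []"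
| "transcript K (Suc t) = bind_pmf (transcript K t) (\<lambda>ps. map_pmf (\<lambda>p. ps @ [p]) (K ps))"

lemma mw_transcript_eq_transcript:
  "mw_transcript \<J> m a \<rho> \<eta> \<epsilon>' \<Delta> b t = transcript (\<lambda>ps. exp_mechanism m \<epsilon>' \<Delta>
     (\<lambda>i. trace_inner \<J> (a i) (mw_iterate \<J> a \<rho> \<eta> ps) - b i)) t"
  by (induction t) simp_all

lemma pmf_transcript:
  "pmf (transcript K t) ps = (if length ps = t then \<Prod>k<t. pmf (K (take k ps)) (ps ! k) else 0)"
proof (induction t arbitrary: ps)
  case 0
  then show ?case by simp
next
  case (Suc t)
  show ?case
  proof (cases ps rule: rev_cases)
    case Nil
    have "pmf (transcript K (Suc t)) [] = 0"
      by (auto simp: pmf_eq_0_set_pmf)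
    then show ?thesis using Nil by simp
  next
    case (snoc qs p)
    have *: "pmf (map_pmf (\<lambda>p. rs @ [p]) (K rs)) ps = (if rs = qs then pmf (K qs) p else 0)" for rs
    proof (cases "rs = qs")
      case True
      have "inj (\<lambda>p. qs @ [p])" by (rule injI) simp
      then show ?thesis using True pmf_map_inj'[of "\<lambda>p. qs @ [p]" "K qs" p] snoc by simp
    qed (auto simp: pmf_eq_0_set_pmf snoc)
    have "pmf (transcript K (Suc t)) ps
        = measure_pmf.expectation (transcript K t) (\<lambda>rs. if rs = qs then pmf (K qs) p else 0)"
      by (simp add: pmf_bind *)
    also have "\<dots> = (\<Sum>rs\<in>{qs}. (if rs = qs then pmf (K qs) p else 0) * pmf (transcript K t) rs)"
      by (rule integral_measure_pmf_real) (auto split: if_splits)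
    also have "\<dots> = (if length ps = Suc t then \<Prod>k<Suc t. pmf (K (take k ps)) (ps ! k) else 0)"
      using Suc.IH[of qs] by (auto simp: snoc nth_append)
    finally show ?thesis .
  qed
qed

lemma nn_integral_transcript_le:
  fixes f :: "'b list \<Rightarrow> ennreal"
  assumes "\<And>ps. (\<integral>\<^sup>+ p. f (ps @ [p]) \<partial>measure_pmf (K ps)) \<le> c * f ps"
  shows "(\<integral>\<^sup>+ ps. f ps \<partial>measure_pmf (transcript K t)) \<le> c ^ t * f []"
proof (induction t)
  case (Suc t)
  have "(\<integral>\<^sup>+ ps. f ps \<partial>measure_pmf (transcript K (Suc t)))
      = (\<integral>\<^sup>+ ps. \<integral>\<^sup>+ p. f (ps @ [p]) \<partial>measure_pmf (K ps) \<partial>measure_pmf (transcript K t))"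
    by simp
  also have "\<dots> \<le> (\<integral>\<^sup>+ ps. c * f ps \<partial>measure_pmf (transcript K t))"
    by (intro nn_integral_mono assms)
  also have "\<dots> = c * (\<integral>\<^sup>+ ps. f ps \<partial>measure_pmf (transcript K t))"
    by (simp add: nn_integral_cmult)
  also have "\<dots> \<le> c * (c ^ t * f [])" by (intro mult_left_mono Suc.IH) simp
  finally show ?case by (simp add: mult.assoc)
qed simp

text \<open>A Chernoff bound for adaptive sums: whatever the past, one more round multiplies the
  expected exponential by at most \<open>c\<close>, so independence of the rounds is not
  involved.\<close>

lemma transcript_tail_bound:
  fixes g :: "'b list \<Rightarrow> 'b \<Rightarrow> real"
  assumes step: "\<And>ps. (\<integral>\<^sup>+ p. ennreal (exp (g ps p)) \<partial>measure_pmf (K ps)) \<le> ennreal c"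
    and c: "0 \<le> c"
  shows "measure_pmf.prob (transcript K t) {ps. u < (\<Sum>k<length ps. g (take k ps) (ps ! k))}
    \<le> c ^ t * exp (- u)"
proof -
  define G where "G ps = (\<Sum>k<length ps. g (take k ps) (ps ! k))" for ps
  have snoc: "ennreal (exp (G (ps @ [p]))) = ennreal (exp (G ps)) * ennreal (exp (g ps p))" for ps p
    by (simp add: G_def nth_append exp_add ennreal_mult)
  have "(\<integral>\<^sup>+ ps. ennreal (exp (G ps)) \<partial>measure_pmf (transcript K t))
      \<le> ennreal c ^ t * ennreal (exp (G []))"
  proof (rule nn_integral_transcript_le)
    fix ps
    have "(\<integral>\<^sup>+ p. ennreal (exp (G (ps @ [p]))) \<partial>measure_pmf (K ps))
        = ennreal (exp (G ps)) * (\<integral>\<^sup>+ p. ennreal (exp (g ps p)) \<partial>measure_pmf (K ps))"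
      unfolding snoc by (simp add: nn_integral_cmult)
    also have "\<dots> \<le> ennreal (exp (G ps)) * ennreal c" by (intro mult_left_mono step) simp
    finally show "(\<integral>\<^sup>+ p. ennreal (exp (G (ps @ [p]))) \<partial>measure_pmf (K ps))
      \<le> ennreal c * ennreal (exp (G ps))" by (simp add: mult.commute)
  qed
  then have E: "(\<integral>\<^sup>+ ps. ennreal (exp (G ps)) \<partial>measure_pmf (transcript K t)) \<le> ennreal (c ^ t)"
    using c by (simp add: G_def ennreal_power)
  have "emeasure (transcript K t) {ps. u < G ps}
      = (\<integral>\<^sup>+ ps. indicator {ps. u < G ps} ps \<partial>measure_pmf (transcript K t))"
    by simp
  also have "\<dots> \<le> (\<integral>\<^sup>+ ps. ennreal (exp (- u)) * ennreal (exp (G ps)) \<partial>measure_pmf (transcript K t))"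
    by (intro nn_integral_mono) (auto simp: indicator_def simp flip: ennreal_mult exp_add)
  also have "\<dots> = ennreal (exp (- u)) * (\<integral>\<^sup>+ ps. ennreal (exp (G ps)) \<partial>measure_pmf (transcript K t))"
    by (simp add: nn_integral_cmult)
  also have "\<dots> \<le> ennreal (exp (- u)) * ennreal (c ^ t)" by (intro mult_left_mono E) simp
  also have "\<dots> = ennreal (c ^ t * exp (- u))" using c by (simp add: mult.commute flip: ennreal_mult)
  finally show ?thesis
    using c by (simp add: measure_pmf.emeasure_eq_measure G_def)
qed

text \<open>Split \<open>S\<close> by the log-likelihood ratio \<open>L\<close> of the whole
  transcript. Where it is at most \<epsilon> the two mass functions compare pointwise; the rest
  falls under the Chernoff bound with exponent \<open>l\<close>.\<close>

lemma transcript_privacy: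
  assumes supp: "\<And>ps. set_pmf (K ps) = set_pmf (K' ps)"
    and step: "\<And>ps. (\<integral>\<^sup>+ p. ennreal (exp (l * ln (pmf (K ps) p / pmf (K' ps) p))) \<partial>measure_pmf (K ps))
      \<le> ennreal (exp \<kappa>)"
    and l: "0 < l"
  shows "measure_pmf.prob (transcript K t) S
    \<le> exp \<epsilon> * measure_pmf.prob (transcript K' t) S + exp (t * \<kappa> - l * \<epsilon>)"
proof -
  define L where "L ps = (\<Sum>k<length ps. ln (pmf (K (take k ps)) (ps ! k) / pmf (K' (take k ps)) (ps ! k)))" for ps
  define B where "B = S \<inter> {ps. L ps \<le> \<epsilon>}"
  have "pmf (transcript K t) ps \<le> exp \<epsilon> * pmf (transcript K' t) ps" if "ps \<in> B" for ps
  \<comment> \<open>In the first case all factors are positive and the logarithms are genuine; in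
    the second the transcript has probability 0.\<close>
  proof (cases "length ps = t \<and> (\<forall>k<t. ps ! k \<in> set_pmf (K (take k ps)))")
    case True
    have "pmf (transcript K t) ps = (\<Prod>k<t. exp (ln (pmf (K (take k ps)) (ps ! k) / pmf (K' (take k ps)) (ps ! k)))
        * pmf (K' (take k ps)) (ps ! k))"
      using True by (auto simp: pmf_transcript supp pmf_positive_iff pmf_eq_0_set_pmf intro!: prod.cong)
    also have "\<dots> = exp (L ps) * pmf (transcript K' t) ps"
      using True by (simp add: pmf_transcript L_def exp_sum prod.distrib)
    also have "\<dots> \<le> exp \<epsilon> * pmf (transcript K' t) ps"
      using that by (intro mult_right_mono) (auto simp: B_def)
    finally show ?thesis .
  next
    case False
    then have "pmf (transcript K t) ps = 0"
      by (auto simp: pmf_transcript pmf_eq_0_set_pmf)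
    then show ?thesis by simp
  qed
  then have "(\<integral>\<^sup>+ ps. ennreal (pmf (transcript K t) ps) \<partial>count_space B)
      \<le> (\<integral>\<^sup>+ ps. ennreal (exp \<epsilon>) * ennreal (pmf (transcript K' t) ps) \<partial>count_space B)"
    by (intro nn_integral_mono) (auto simp flip: ennreal_mult intro!: ennreal_leI)
  then have "emeasure (transcript K t) B \<le> ennreal (exp \<epsilon>) * emeasure (transcript K' t) B"
    by (simp add: nn_integral_cmult nn_integral_pmf)
  then have 1: "measure_pmf.prob (transcript K t) B \<le> exp \<epsilon> * measure_pmf.prob (transcript K' t) B"
    by (simp add: measure_pmf.emeasure_eq_measure flip: ennreal_mult)
  have "measure_pmf.prob (transcript K t) {ps. l * \<epsilon> < (\<Sum>k<length ps.
      l * ln (pmf (K (take k ps)) (ps ! k) / pmf (K' (take k ps)) (ps ! k)))} \<le> exp \<kappa> ^ t * exp (- (l * \<epsilon>))"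
    by (rule transcript_tail_bound[OF step]) simp
  then have 2: "measure_pmf.prob (transcript K t) {ps. \<epsilon> < L ps} \<le> exp (t * \<kappa> - l * \<epsilon>)"
    using l by (simp add: L_def exp_diff exp_minus exp_of_nat2_mult field_simps flip: sum_distrib_left)
  have "measure_pmf.prob (transcript K t) S \<le> measure_pmf.prob (transcript K t) (B \<union> {ps. \<epsilon> < L ps})"
    by (rule measure_pmf.finite_measure_mono) (auto simp: B_def)
  also have "\<dots> \<le> measure_pmf.prob (transcript K t) B + measure_pmf.prob (transcript K t) {ps. \<epsilon> < L ps}"
    by (rule measure_Un_le) auto
  also have "\<dots> \<le> exp \<epsilon> * measure_pmf.prob (transcript K' t) B + exp (t * \<kappa> - l * \<epsilon>)"
    using 1 2 by (rule add_mono)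
  also have "measure_pmf.prob (transcript K' t) B \<le> measure_pmf.prob (transcript K' t) S"
    by (rule measure_pmf.finite_measure_mono) (auto simp: B_def)
  finally show ?thesis by simp
qed

text \<open>Hoeffding's lemma is applied twice: at exponent \<open>-1\<close>, where the moment generating function of
  the privacy loss equals 1, it bounds the mean of the loss; at exponent \<open>l\<close> it bounds the moment.\<close>

lemma bounded_range_moment:
  fixes P P' :: "'b pmf"
  assumes supp: "set_pmf P = set_pmf P'"
    and range: "\<And>x. x \<in> set_pmf P \<Longrightarrow> ln (pmf P x / pmf P' x) \<in> {a..a + d}"
    and l: "0 < l"
  shows "(\<integral>\<^sup>+ x. ennreal (exp (l * ln (pmf P x / pmf P' x))) \<partial>measure_pmf P)
    \<le> ennreal (exp ((l + l\<^sup>2) * d\<^sup>2 / 8))"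
proof -
  define L where "L x = ln (pmf P x / pmf P' x)" for x
  define \<mu> where "\<mu> = measure_pmf.expectation P L"
  interpret pos: interval_bounded_random_variable "measure_pmf P" L a "a + d"
    using range by unfold_locales (auto simp: AE_measure_pmf_iff L_def)
  interpret neg: interval_bounded_random_variable "measure_pmf P" "\<lambda>x. - L x" "- (a + d)" "- a"
    using range by unfold_locales (auto simp: AE_measure_pmf_iff L_def simp del: minus_add_distrib)
  have "(\<integral>\<^sup>+ x. ennreal (exp (- L x)) \<partial>measure_pmf P)
      = (\<integral>\<^sup>+ x. ennreal (pmf P x) * ennreal (exp (- L x)) \<partial>count_space UNIV)"
    by (rule nn_integral_measure_pmf)
  also have "\<dots> = (\<integral>\<^sup>+ x. ennreal (pmf P' x) \<partial>count_space UNIV)"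
  proof (rule nn_integral_cong)
    fix x
    show "ennreal (pmf P x) * ennreal (exp (- L x)) = ennreal (pmf P' x)"
    proof (cases "x \<in> set_pmf P")
      case True
      then have "0 < pmf P x" "0 < pmf P' x" using supp by (auto simp: pmf_positive_iff)
      then have "pmf P x * exp (- L x) = pmf P' x" by (simp add: L_def exp_minus)
      then show ?thesis by (simp flip: ennreal_mult)
    next
      case False
      then have "pmf P x = 0" "pmf P' x = 0" using supp by (auto simp: pmf_eq_0_set_pmf)
      then show ?thesis by simp
    qed
  qed
  also have "\<dots> = 1" by (simp add: nn_integral_pmf)
  finally have one: "(\<integral>\<^sup>+ x. ennreal (exp (- L x)) \<partial>measure_pmf P) = 1" .
  have shift: "(\<integral>\<^sup>+ x. ennreal (exp (f x + c)) \<partial>measure_pmf P)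
      = ennreal (exp c) * (\<integral>\<^sup>+ x. ennreal (exp (f x)) \<partial>measure_pmf P)" for f c
    by (simp add: exp_add ennreal_mult mult.commute[of "ennreal (exp c)"] nn_integral_multc)
  have "ennreal (exp \<mu>) = (\<integral>\<^sup>+ x. ennreal (exp (1 * (- L x - measure_pmf.expectation P (\<lambda>x. - L x)))) \<partial>measure_pmf P)"
    using shift[of "\<lambda>x. - L x" \<mu>] one by (simp add: \<mu>_def)
  also have "\<dots> \<le> ennreal (exp (1\<^sup>2 * (- a - - (a + d))\<^sup>2 / 8))"
    by (rule neg.Hoeffdings_lemma_nn_integral) simp
  finally have \<mu>: "\<mu> \<le> d\<^sup>2 / 8" by simp
  have "(\<integral>\<^sup>+ x. ennreal (exp (l * L x)) \<partial>measure_pmf P)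
      = ennreal (exp (l * \<mu>)) * (\<integral>\<^sup>+ x. ennreal (exp (l * (L x - measure_pmf.expectation P L))) \<partial>measure_pmf P)"
    using shift[of "\<lambda>x. l * (L x - \<mu>)" "l * \<mu>"] by (simp add: \<mu>_def algebra_simps)
  also have "\<dots> \<le> ennreal (exp (l * \<mu>)) * ennreal (exp (l\<^sup>2 * (a + d - a)\<^sup>2 / 8))"
    by (intro mult_left_mono pos.Hoeffdings_lemma_nn_integral l) simp
  also have "\<dots> = ennreal (exp (l * \<mu> + l\<^sup>2 * d\<^sup>2 / 8))" by (simp add: exp_add ennreal_mult)
  also have "\<dots> \<le> ennreal (exp (l * (d\<^sup>2 / 8) + l\<^sup>2 * d\<^sup>2 / 8))"
    using \<mu> l by (intro ennreal_leI) auto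
  also have "l * (d\<^sup>2 / 8) + l\<^sup>2 * d\<^sup>2 / 8 = (l + l\<^sup>2) * d\<^sup>2 / 8" by (simp add: algebra_simps)
  finally show ?thesis by (simp add: L_def)
qed

text \<open>The normalisers shift the loss by the same constant for every outcome. Only the score
  difference varies, within \<epsilon>/2 in either direction, so the loss lives in an interval of
  length \<epsilon>.\<close>

lemma exp_mechanism_moment:
  assumes m: "1 \<le> m" and \<Delta>: "0 < \<Delta>" and \<epsilon>: "0 \<le> \<epsilon>"
    and Q: "\<And>i. i < m \<Longrightarrow> \<bar>Q i - Q' i\<bar> \<le> \<Delta>" and l: "0 < l"
  shows "(\<integral>\<^sup>+ i. ennreal (exp (l * ln (pmf (exp_mechanism m \<epsilon> \<Delta> Q) i / pmf (exp_mechanism m \<epsilon> \<Delta> Q') i)))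
      \<partial>measure_pmf (exp_mechanism m \<epsilon> \<Delta> Q)) \<le> ennreal (exp ((l + l\<^sup>2) * \<epsilon>\<^sup>2 / 8))"
proof (rule bounded_range_moment)
  define s where "s = \<epsilon> / (2 * \<Delta>)"
  define Z where "Z Q = (\<Sum>j<m. exp (s * Q j))" for Q
  have Z: "0 < Z Q" for Q unfolding Z_def using m by (intro sum_pos) (auto simp: lessThan_empty_iff)
  fix i assume "i \<in> set_pmf (exp_mechanism m \<epsilon> \<Delta> Q)"
  then have i: "i < m" by (simp add: set_pmf_exp_mechanism[OF m])
  have pmf: "pmf (exp_mechanism m \<epsilon> \<Delta> Q) i = exp (s * Q i) / Z Q" for Q
    using i by (simp add: pmf_exp_mechanism[OF m] s_def Z_def)
  have pos: "0 < exp (s * Q i) / Z Q" for Q using Z by simp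
  have lnp: "ln (exp (s * Q i) / Z Q) = s * Q i - ln (Z Q)" for Q
    using ln_divide_pos[OF exp_gt_zero Z] by simp
  have eq: "ln (pmf (exp_mechanism m \<epsilon> \<Delta> Q) i / pmf (exp_mechanism m \<epsilon> \<Delta> Q') i)
      = s * (Q i - Q' i) - (ln (Z Q) - ln (Z Q'))"
    unfolding pmf ln_divide_pos[OF pos pos] lnp by (simp add: algebra_simps)
  have "\<bar>s * (Q i - Q' i)\<bar> \<le> s * \<Delta>"
    using mult_left_mono[OF Q[OF i], of s] \<epsilon> \<Delta> by (simp add: abs_mult s_def)
  also have "\<dots> = \<epsilon> / 2" using \<Delta> by (simp add: s_def)
  finally have "\<bar>s * (Q i - Q' i)\<bar> \<le> \<epsilon> / 2" .
  then show "ln (pmf (exp_mechanism m \<epsilon> \<Delta> Q) i / pmf (exp_mechanism m \<epsilon> \<Delta> Q') i)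
    \<in> {- \<epsilon> / 2 - (ln (Z Q) - ln (Z Q'))..- \<epsilon> / 2 - (ln (Z Q) - ln (Z Q')) + \<epsilon>}"
    unfolding eq by (auto simp: abs_le_iff)
qed (use m l in \<open>simp_all add: set_pmf_exp_mechanism[OF m]\<close>)

text \<open>The exponential of the gap cancels the sampling weight, so all \<open>m\<close> outcomes
  contribute the same amount. It is at most 1, because the normaliser includes the weight of the
  maximum.\<close>

lemma exp_mechanism_gap:
  assumes m: "1 \<le> m" and \<Delta>: "0 < \<Delta>" and \<epsilon>: "0 \<le> \<epsilon>"
  shows "(\<integral>\<^sup>+ p. ennreal (exp (\<epsilon> / (2 * \<Delta>) * (Max (Q ` {..<m}) - Q p))) \<partial>measure_pmf (exp_mechanism m \<epsilon> \<Delta> Q))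
    \<le> ennreal (real m)"
proof -
  define s where "s = \<epsilon> / (2 * \<Delta>)"
  define Z where "Z = (\<Sum>j<m. exp (s * Q j))"
  let ?M = "Max (Q ` {..<m})"
  have ne: "Q ` {..<m} \<noteq> {}" using m by (auto simp: lessThan_empty_iff)
  then have "?M \<in> Q ` {..<m}" by (intro Max_in) auto
  then obtain i where i: "i < m" "?M = Q i" by auto
  have ZM: "exp (s * ?M) \<le> Z" unfolding Z_def i(2) using i(1) by (intro member_le_sum) auto
  then have Z: "0 < Z" using exp_gt_zero less_le_trans by blast
  have "(\<integral>\<^sup>+ p. ennreal (exp (s * (?M - Q p))) \<partial>measure_pmf (exp_mechanism m \<epsilon> \<Delta> Q))
      = (\<Sum>p<m. ennreal (exp (s * (?M - Q p))) * ennreal (pmf (exp_mechanism m \<epsilon> \<Delta> Q) p))"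
    using nn_integral_measure_pmf_finite[of "exp_mechanism m \<epsilon> \<Delta> Q" "\<lambda>p. ennreal (exp (s * (?M - Q p)))"]
    by (simp add: set_pmf_exp_mechanism[OF m])
  also have "\<dots> = (\<Sum>p<m. ennreal (exp (s * ?M) / Z))"
  proof (intro sum.cong refl)
    fix p assume "p \<in> {..<m}"
    then have "exp (s * (?M - Q p)) * pmf (exp_mechanism m \<epsilon> \<Delta> Q) p = exp (s * ?M) / Z"
      by (simp add: pmf_exp_mechanism[OF m] right_diff_distrib exp_diff flip: s_def Z_def)
    then show "ennreal (exp (s * (?M - Q p))) * ennreal (pmf (exp_mechanism m \<epsilon> \<Delta> Q) p) = ennreal (exp (s * ?M) / Z)"
      by (simp flip: ennreal_mult)
  qed
  also have "\<dots> = ennreal (real m * (exp (s * ?M) / Z))"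
    using Z by (subst ennreal_mult) (auto simp: ennreal_of_nat_eq_real_of_nat)
  also have "\<dots> \<le> ennreal (real m)"
    using ZM Z by (intro ennreal_leI mult_left_le) auto
  finally show ?thesis by (simp add: s_def)
qed

section \<open>Privacy and accuracy of the algorithm\<close>

text \<open>\<open>l\<close> is the minimiser of the left-hand side. At this point the claim is
  equivalent to (48 D - \<epsilon>)(80 D - \<epsilon>) \<ge> 0, which is where the constant 48 comes
  from.\<close>

lemma privacy_exponent:
  fixes D \<epsilon> :: real
  assumes "0 < D" "0 < \<epsilon>" "\<epsilon> \<le> 48 * D" and l: "l = (64 * D / \<epsilon> - 1) / 2"
  shows "(l + l\<^sup>2) * (\<epsilon>\<^sup>2 / (8 * D)) / 8 - l * \<epsilon> \<le> - D"
proof -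
  have "0 \<le> (48 * D - \<epsilon>) * (80 * D - \<epsilon>)" using assms by (intro mult_nonneg_nonneg) auto
  also have "\<dots> = - 256 * D * ((l + l\<^sup>2) * (\<epsilon>\<^sup>2 / (8 * D)) / 8 - l * \<epsilon> + D)"
    unfolding l using assms by (simp add: field_simps power2_eq_square)
  finally show ?thesis using \<open>0 < D\<close> by (simp add: mult_le_0_iff)
qed

lemma neighboringD:
  assumes "neighboring m \<Delta> b b'" "i < m"
  shows "\<bar>b i - b' i\<bar> \<le> \<Delta>"
proof -
  have "\<bar>b i - b' i\<bar> \<le> linf_norm m (\<lambda>i. b i - b' i)"
    unfolding linf_norm_def using assms(2) by (intro Max_ge) auto
  then show ?thesis using assms(1) by (simp add: neighboring_def)
qed

text \<open>The output is a function of the transcript that does not involve \<open>b\<close>, so it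
  suffices to compare transcripts. Given equal past answers both runs hold the same iterate, and the
  scores differ only by \<open>b\<close> against \<open>b'\<close>.\<close>

lemma mw_mechanism_private:
  assumes m: "1 \<le> m" and \<epsilon>: "0 < \<epsilon>" and \<delta>: "0 < \<delta>" "\<delta> < 1" and \<Delta>: "0 < \<Delta>"
    and le: "\<epsilon> \<le> 48 * ln (1 / \<delta>)"
  shows "low_sens_scalar_private X m \<Delta> \<epsilon> \<delta> (mw_mechanism \<J> m a \<epsilon> \<delta> \<Delta> \<alpha>)"
  unfolding low_sens_scalar_private_def
proof (intro allI impI)
  fix b b' and S
  assume nb: "neighboring m \<Delta> b b'"
  define \<rho> \<eta> T where "\<rho> = width \<J> m a" and "\<eta> = \<alpha> / (4 * \<rho>)" and "T = num_rounds \<rho> (jrank \<J>) \<alpha>"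
  define D where "D = ln (1 / \<delta>)"
  define \<epsilon>' where "\<epsilon>' = \<epsilon> / sqrt (8 * real T * D)"
  define Q where "Q b ps i = trace_inner \<J> (a i) (mw_iterate \<J> a \<rho> \<eta> ps) - b i" for b ps i
  define K where "K b ps = exp_mechanism m \<epsilon>' \<Delta> (Q b ps)" for b ps
  define h where "h ps = (1 / real T) *\<^sub>R (\<Sum>t<T. mw_iterate \<J> a \<rho> \<eta> (take t ps))" for ps
  have M: "mw_mechanism \<J> m a \<epsilon> \<delta> \<Delta> \<alpha> b = map_pmf h (transcript (K b) T)" for b
    by (simp add: mw_mechanism_def Let_def mw_transcript_eq_transcript K_def[abs_def] Q_def[abs_def] h_def[abs_def]
        \<rho>_def \<eta>_def T_def D_def \<epsilon>'_def)
  have D: "0 < D" using \<delta> by (simp add: D_def)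
  have T: "0 < T" by (simp add: T_def num_rounds_def)
  \<comment> \<open>The number of rounds cancels, so the privacy bound is the same for every
    \<alpha>.\<close>
  have e': "0 < \<epsilon>'" "real T * \<epsilon>'\<^sup>2 = \<epsilon>\<^sup>2 / (8 * D)"
    using \<epsilon> D T by (simp_all add: \<epsilon>'_def power_divide)
  define l where "l = (64 * D / \<epsilon> - 1) / 2"
  have "64 / 48 * \<epsilon> \<le> 64 * D" using le by (simp add: D_def)
  then have l: "0 < l" using \<epsilon> by (simp add: l_def field_simps)
  have "measure_pmf.prob (transcript (K b) T) (h -` S)
    \<le> exp \<epsilon> * measure_pmf.prob (transcript (K b') T) (h -` S) + exp (T * ((l + l\<^sup>2) * \<epsilon>'\<^sup>2 / 8) - l * \<epsilon>)"
  proof (rule transcript_privacy[OF _ _ l])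
    show "set_pmf (K b ps) = set_pmf (K b' ps)" for ps
      by (simp add: K_def set_pmf_exp_mechanism[OF m])
    show "(\<integral>\<^sup>+ p. ennreal (exp (l * ln (pmf (K b ps) p / pmf (K b' ps) p))) \<partial>measure_pmf (K b ps))
      \<le> ennreal (exp ((l + l\<^sup>2) * \<epsilon>'\<^sup>2 / 8))" for ps
      unfolding K_def using e'(1) neighboringD[OF nb]
      by (intro exp_mechanism_moment[OF m \<Delta> _ _ l]) (auto simp: Q_def abs_minus_commute)
  qed
  also have "T * ((l + l\<^sup>2) * \<epsilon>'\<^sup>2 / 8) - l * \<epsilon> = (l + l\<^sup>2) * (\<epsilon>\<^sup>2 / (8 * D)) / 8 - l * \<epsilon>"
    unfolding e'(2)[symmetric] by simp
  also have "exp \<dots> \<le> exp (- D)"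
    using privacy_exponent[OF D \<epsilon> _ l_def] le by (simp add: D_def)
  also have "exp (- D) = \<delta>" using \<delta> by (simp add: D_def ln_div)
  finally show "measure_pmf.prob (mw_mechanism \<J> m a \<epsilon> \<delta> \<Delta> \<alpha> b) S
      \<le> exp \<epsilon> * measure_pmf.prob (mw_mechanism \<J> m a \<epsilon> \<delta> \<Delta> \<alpha> b') S + \<delta>"
    by (simp add: M)
qed

text \<open>Solves the circular dependence of \<alpha>, the number of rounds and the per-round
  budget. The selection error is at most 64 f^2 / \<alpha> for the unscaled bound f, so \<alpha> =
  16 f makes it at most \<alpha>/4.\<close>

lemma accuracy_parameters:
  fixes r m :: nat and \<rho> \<Delta> \<epsilon> \<delta> \<beta> :: real
  assumes r: "2 \<le> r" and m: "1 \<le> m" and \<Delta>: "0 < \<Delta>" and \<epsilon>: "0 < \<epsilon>" and \<delta>: "0 < \<delta>" "\<delta> < 1"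
    and \<beta>: "0 < \<beta>" "\<beta> < 1" and \<alpha>: "\<alpha> = 16 * mw_accuracy_bound (r, m, \<rho>, \<Delta>, \<epsilon>, \<delta>, \<beta>)"
    and \<rho>: "0 < \<rho>" and lt: "\<alpha> < 2 * \<rho>" and T: "T = num_rounds \<rho> r \<alpha>"
  shows "0 < \<alpha>" "4 * \<rho>\<^sup>2 / \<alpha> * ln (real r) / real T \<le> \<alpha> / 4"
    "(ln (real m) + ln (1 / \<beta>) / real T) * (2 * \<Delta> * sqrt (8 * real T * ln (1 / \<delta>)) / \<epsilon>) \<le> \<alpha> / 4"
proof -
  define D where "D = ln (1 / \<delta>)"
  define R where "R = ln (real r)"
  define Lm Lb where "Lm = log_ge1 (real m)" and "Lb = log_ge1 (1 / \<beta>)"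
  have D: "0 < D" using \<delta> by (simp add: D_def)
  have L: "1 \<le> Lm" "ln (real m) \<le> Lm" "1 \<le> Lb" "ln (1 / \<beta>) \<le> Lb" by (simp_all add: Lm_def Lb_def log_ge1_def)
  \<comment> \<open>A crude value suffices: with \<alpha> < 2\<rho> it gives
    \<open>1 \<le> X\<close>, so that rounding up at most doubles the number of rounds.\<close>
  have "1 / 4 \<le> ln (2 :: real)" using ln_le_minus_one[of "1 / 2 :: real"] by (simp add: ln_div)
  also have "ln 2 \<le> R" using r by (simp add: R_def)
  finally have R: "1 / 4 \<le> R" .
  define f where "f = mw_accuracy_bound (r, m, \<rho>, \<Delta>, \<epsilon>, \<delta>, \<beta>)"
  have f_eq: "f = \<rho> powr (1/2) * \<Delta> powr (1/2) / \<epsilon> powr (1/2) * R powr (1/4) * D powr (1/4)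
       * Lb powr (1/2) * Lm powr (1/2)"
    by (simp add: f_def R_def D_def Lm_def Lb_def)
  have f0: "0 < f" unfolding f_eq using \<rho> \<Delta> \<epsilon> R D L by simp
  then show a0: "0 < \<alpha>" unfolding \<alpha> f_def[symmetric] by simp
  have half: "(x powr (1/2))\<^sup>2 = x" and quarter: "(x powr (1/4))\<^sup>2 = sqrt x" if "0 < x" for x :: real
    using that by (simp_all add: powr_power powr_half_sqrt[symmetric])
  have f2: "f\<^sup>2 = \<rho> * \<Delta> / \<epsilon> * sqrt R * sqrt D * Lb * Lm"
    unfolding f_eq using \<rho> \<Delta> \<epsilon> R D L by (simp add: power_mult_distrib power_divide half quarter)
  have \<alpha>2: "\<alpha>\<^sup>2 = 256 * f\<^sup>2" unfolding \<alpha> f_def[symmetric] by (simp add: power_mult_distrib)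
  define X where "X = 16 * \<rho>\<^sup>2 * R / \<alpha>\<^sup>2"
  have "\<alpha>\<^sup>2 \<le> (2 * \<rho>)\<^sup>2" using lt a0 by (intro power_mono) auto
  also have "\<dots> \<le> 16 * \<rho>\<^sup>2 * R" using R \<rho> by (simp add: power_mult_distrib)
  finally have X1: "1 \<le> X" using a0 by (simp add: X_def)
  have Teq: "real T = of_int \<lceil>X\<rceil>"
  proof -
    have "1 \<le> \<lceil>X\<rceil>" using X1 by linarith
    then have "max 1 (nat \<lceil>X\<rceil>) = nat \<lceil>X\<rceil>" by linarith
    moreover have "T = max 1 (nat \<lceil>X\<rceil>)" by (simp add: T num_rounds_def X_def R_def)
    ultimately show ?thesis using \<open>1 \<le> \<lceil>X\<rceil>\<close> by simp
  qed
  have TX: "X \<le> real T" "real T \<le> 2 * X" unfolding Teq using X1 by linarith+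
  have T1: "1 \<le> real T" using TX X1 by linarith
  have "4 * \<rho>\<^sup>2 / \<alpha> * R / real T \<le> 4 * \<rho>\<^sup>2 / \<alpha> * R / X"
    using TX X1 a0 R by (intro divide_left_mono) auto
  also have "\<dots> = \<alpha> / 4" using a0 R \<rho> by (simp add: X_def field_simps power2_eq_square)
  finally show "4 * \<rho>\<^sup>2 / \<alpha> * ln (real r) / real T \<le> \<alpha> / 4" by (simp add: R_def)
  have "8 * real T * D \<le> 8 * (2 * X) * D" using TX D by (intro mult_mono) auto
  also have "\<dots> = (16 * \<rho> / \<alpha>)\<^sup>2 * (R * D)" by (simp add: X_def power_divide power_mult_distrib)
  finally have "sqrt (8 * real T * D) \<le> sqrt ((16 * \<rho> / \<alpha>)\<^sup>2 * (R * D))" by simp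
  also have "\<dots> = 16 * \<rho> / \<alpha> * (sqrt R * sqrt D)" using \<rho> a0 by (simp add: real_sqrt_mult)
  finally have S: "sqrt (8 * real T * D) \<le> 16 * \<rho> / \<alpha> * (sqrt R * sqrt D)" .
  have "ln (1 / \<beta>) / real T \<le> ln (1 / \<beta>)"
    using T1 \<beta> by (simp add: field_simps mult_le_cancel_left1)
  then have "ln (real m) + ln (1 / \<beta>) / real T \<le> Lm + Lb" using L by linarith
  \<comment> \<open>The lower cutoff at 1 of both logarithms turns their sum into the product that
    occurs in the bound.\<close>
  also have "\<dots> \<le> 2 * (Lm * Lb)"
  proof -
    have "0 \<le> (Lm - 1) * Lb + Lm * (Lb - 1)" using L by (intro add_nonneg_nonneg mult_nonneg_nonneg) auto
    then show ?thesis by (simp add: algebra_simps)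
  qed
  finally have "(ln (real m) + ln (1 / \<beta>) / real T) * (2 * \<Delta> * sqrt (8 * real T * D) / \<epsilon>)
      \<le> (2 * (Lm * Lb)) * (2 * \<Delta> * (16 * \<rho> / \<alpha> * (sqrt R * sqrt D)) / \<epsilon>)"
    using S L \<Delta> \<epsilon> D T1 by (intro mult_mono divide_right_mono) auto
  also have "\<dots> = 64 * (\<rho> * \<Delta> / \<epsilon> * sqrt R * sqrt D * Lb * Lm) / \<alpha>" by (simp add: mult_ac)
  also have "\<dots> = \<alpha> / 4" unfolding f2[symmetric] using \<alpha>2 a0 by (simp add: field_simps power2_eq_square)
  finally show "(ln (real m) + ln (1 / \<beta>) / real T) * (2 * \<Delta> * sqrt (8 * real T * ln (1 / \<delta>)) / \<epsilon>) \<le> \<alpha> / 4"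
    by (simp add: D_def)
qed

lemma pmf_prob_complement_bound:
  assumes "\<And>x. x \<in> set_pmf p \<Longrightarrow> x \<notin> B \<Longrightarrow> x \<in> A" and "measure_pmf.prob p B \<le> \<beta>"
  shows "1 - \<beta> \<le> measure_pmf.prob p A"
proof -
  have "1 = measure_pmf.prob p (UNIV \<inter> set_pmf p)" by (simp only: measure_Int_set_pmf) simp
  also have "\<dots> \<le> measure_pmf.prob p (A \<union> B)"
    using assms(1) by (intro measure_pmf.finite_measure_mono) auto
  also have "\<dots> \<le> measure_pmf.prob p A + measure_pmf.prob p B" by (rule measure_Un_le) auto
  finally show ?thesis using assms(2) by linarith
qed

context euclidean_jordan_algebra
begin

lemma jrank_1_density:
  assumes r: "jrank \<J> = 1" and x: "x \<in> J" "jtrace \<J> x = 1"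
  shows "x = \<e>"
proof -
  obtain F l where F: "jordan_frame \<J> F" and xF: "x = (\<Sum>q\<in>F. l q *\<^sub>R q)"
    using x(1) by (rule spectral_frame_exists)
  have "card F = 1" using card_jordan_frame[OF F] r by simp
  then obtain q where q: "F = {q}" by (auto simp: card_1_singleton_iff)
  have "l q = 1" using jtrace_frame[OF F, of l] x(2) xF q by simp
  then show ?thesis using jordan_frameD(2)[OF F] xF q by simp
qed

text \<open>The axioms admit the zero algebra, whose frame is empty; an element of trace 1 excludes
  it.\<close>

lemma jrank_pos:
  assumes "x \<in> J" "jtrace \<J> x = 1"
  shows "0 < jrank \<J>"
proof (rule ccontr)
  assume "\<not> 0 < jrank \<J>"
  then have "spectral_frame \<J> x = {}"
    using card_jordan_frame jordan_frameD(4) spectral_frame_jordan(1)[OF assms(1)] by fastforce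
  then show False using assms(2) by (simp add: jtrace_def)
qed

text \<open>Regret bounds the total score of the sampled constraints, and the accumulated gap
  compares any fixed constraint with them. If \<alpha> \<ge> 2\<rho> or the rank is 1, every outcome
  is accurate.\<close>

lemma mw_mechanism_accurate:
  assumes m: "1 \<le> m" and a: "\<And>i. i < m \<Longrightarrow> a i \<in> J" and \<epsilon>: "0 < \<epsilon>" and \<delta>: "0 < \<delta>" "\<delta> < 1"
    and \<beta>: "0 < \<beta>" "\<beta> < 1" and \<Delta>: "0 < \<Delta>"
    and x: "x \<in> cone_of_squares \<J>" "jtrace \<J> x = 1" and feas: "\<And>i. i < m \<Longrightarrow> trace_inner \<J> (a i) x \<le> b i"
    and \<alpha>: "\<alpha> = 16 * mw_accuracy_bound (jrank \<J>, m, width \<J> m a, \<Delta>, \<epsilon>, \<delta>, \<beta>)"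
  shows "1 - \<beta> \<le> measure_pmf.prob (mw_mechanism \<J> m a \<epsilon> \<delta> \<Delta> \<alpha> b)
    {x \<in> cone_of_squares \<J>. \<forall>i<m. trace_inner \<J> (a i) x \<le> b i + \<alpha>}"
proof -
  define \<rho> \<eta> T where "\<rho> = width \<J> m a" and "\<eta> = \<alpha> / (4 * \<rho>)" and "T = num_rounds \<rho> (jrank \<J>) \<alpha>"
  define D where "D = ln (1 / \<delta>)"
  define \<epsilon>' where "\<epsilon>' = \<epsilon> / sqrt (8 * real T * D)"
  define X where "X ps = mw_iterate \<J> a \<rho> \<eta> ps" for ps
  define Q where "Q ps i = trace_inner \<J> (a i) (X ps) - b i" for ps i
  define K where "K ps = exp_mechanism m \<epsilon>' \<Delta> (Q ps)" for ps
  define h where "h ps = (1 / real T) *\<^sub>R (\<Sum>t<T. X (take t ps))" for ps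
  have M: "mw_mechanism \<J> m a \<epsilon> \<delta> \<Delta> \<alpha> b = map_pmf h (transcript K T)"
    by (simp add: mw_mechanism_def Let_def mw_transcript_eq_transcript K_def[abs_def] Q_def[abs_def] h_def[abs_def]
        \<rho>_def \<eta>_def T_def D_def \<epsilon>'_def X_def[abs_def])
  note xJ = cone_carrier[OF x(1)]
  have r: "0 < jrank \<J>" using jrank_pos[OF xJ x(2)] .
  have norm: "spectral_norm \<J> (a i) \<le> \<rho>" if "i < m" for i
    unfolding \<rho>_def width_def using that by (intro Max_ge) auto
  have \<rho>0: "0 \<le> \<rho>" using norm[of 0] spectral_norm_nonneg[OF a r, of 0] m by simp
  have T: "0 < T" by (simp add: T_def num_rounds_def)
  have D: "0 < D" using \<delta> by (simp add: D_def)
  have supp: "length ps = T" "set ps \<subseteq> {..<m}" if "ps \<in> set_pmf (transcript K T)" for ps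
  proof -
    have nz: "pmf (transcript K T) ps \<noteq> 0" using that by (simp add: set_pmf_iff)
    then show len: "length ps = T" by (auto simp: pmf_transcript split: if_splits)
    have "ps ! k < m" if "k < T" for k
    proof -
      have "pmf (K (take k ps)) (ps ! k) \<noteq> 0" using nz len that by (auto simp: pmf_transcript)
      then show ?thesis by (auto simp: K_def pmf_exp_mechanism[OF m] split: if_splits)
    qed
    then show "set ps \<subseteq> {..<m}" using len by (auto simp: in_set_conv_nth)
  qed
  have dens: "X (take k ps) \<in> cone_of_squares \<J>" "jtrace \<J> (X (take k ps)) = 1"
    if "ps \<in> set_pmf (transcript K T)" for k ps
    unfolding X_def using supp(2)[OF that] a r
    by (intro mw_iterate_density; force dest: in_set_takeD)+
  have hcone: "h ps \<in> cone_of_squares \<J>" if "ps \<in> set_pmf (transcript K T)" for ps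
    unfolding h_def by (intro cone_scale cone_sum dens that) simp
  have havg: "trace_inner \<J> (a i) (h ps) = (\<Sum>t<T. trace_inner \<J> (a i) (X (take t ps))) / real T"
    if "ps \<in> set_pmf (transcript K T)" "i < m" for i ps
    using cone_carrier[OF dens(1)[OF that(1)]] a[OF that(2)] by (simp add: h_def trace_inner_linear)
  have havg_le: "trace_inner \<J> (a i) (h ps) \<le> c"
    if "ps \<in> set_pmf (transcript K T)" "i < m" "\<And>t. t < T \<Longrightarrow> trace_inner \<J> (a i) (X (take t ps)) \<le> c" for i ps c
  proof -
    have "(\<Sum>t<T. trace_inner \<J> (a i) (X (take t ps))) \<le> real T * c"
      using sum_bounded_above[of "{..<T}" "\<lambda>t. trace_inner \<J> (a i) (X (take t ps))" c] that(3) by simp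
    then show ?thesis using T by (simp add: havg[OF that(1,2)] field_simps)
  qed
  have bound: "\<bar>trace_inner \<J> (a i) v\<bar> \<le> \<rho>" if "i < m" "v \<in> cone_of_squares \<J>" "jtrace \<J> v = 1" for i v
    using jtrace_spectral_norm(1)[OF a[OF that(1)] that(2)] norm[OF that(1)] that(3)
    by (simp add: trace_inner_def)
  \<comment> \<open>The failure event. Each round contributes a factor \<open>m\<close> to the
    moment bound, and the threshold is chosen so that the tail bound is exactly \<beta>.\<close>
  define B where "B = (if 2 * \<rho> \<le> \<alpha> \<or> jrank \<J> = 1 then {} else
    {ps. real T * ln (real m) + ln (1 / \<beta>) < (\<Sum>k<length ps. \<epsilon>' / (2 * \<Delta>) *
      (Max (Q (take k ps) ` {..<m}) - Q (take k ps) (ps ! k)))})"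
  have \<epsilon>'0: "0 < \<epsilon>'" using \<epsilon> T D by (simp add: \<epsilon>'_def)
  have PB: "measure_pmf.prob (transcript K T) B \<le> \<beta>"
  proof (cases "2 * \<rho> \<le> \<alpha> \<or> jrank \<J> = 1")
    case False
    have "measure_pmf.prob (transcript K T) B \<le> real m ^ T * exp (- (real T * ln (real m) + ln (1 / \<beta>)))"
      unfolding B_def if_not_P[OF False] K_def
      by (rule transcript_tail_bound) (use exp_mechanism_gap[OF m \<Delta>] \<epsilon>'0 in auto)
    also have "\<dots> = \<beta>"
      using m \<beta> by (simp add: exp_add exp_diff exp_minus ln_div exp_of_nat_mult)
    finally show ?thesis .
  qed (use \<beta> in \<open>simp add: B_def\<close>)
  have "h ps \<in> cone_of_squares \<J> \<and> (\<forall>i<m. trace_inner \<J> (a i) (h ps) \<le> b i + \<alpha>)"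
    if ps: "ps \<in> set_pmf (transcript K T)" "ps \<notin> B" for ps
  proof (intro conjI hcone ps allI impI)
    fix i assume i: "i < m"
    show "trace_inner \<J> (a i) (h ps) \<le> b i + \<alpha>"
    proof (cases "2 * \<rho> \<le> \<alpha> \<or> jrank \<J> = 1")
      case True
      then show ?thesis
      proof
        assume "2 * \<rho> \<le> \<alpha>"
        \<comment> \<open>Feasibility forces \<open>b i\<close> to be at least -\<rho>, so a slack
          of 2\<rho> covers every density.\<close>
        then have "\<rho> \<le> b i + \<alpha>" using bound[OF i x] feas[OF i] by linarith
        then show ?thesis
          using bound[OF i dens[OF ps(1)]] by (intro havg_le ps i) (meson abs_le_D1 order_trans)
      next
        assume r1: "jrank \<J> = 1"
        \<comment> \<open>In rank 1 the bound is 0 because ln 1 = 0, so the constraints have to hold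
          exactly. They do, since the only density is the feasible point.\<close>
        have "0 \<le> \<alpha>" by (simp add: \<alpha> r1)
        moreover have "X (take t ps) = x" for t
          using jrank_1_density[OF r1 cone_carrier[OF dens(1)] dens(2), OF ps(1) ps(1)]
            jrank_1_density[OF r1 xJ x(2)] by simp
        ultimately show ?thesis using feas[OF i] by (intro havg_le ps i) simp
      qed
    next
      case False
      then have lt: "\<alpha> < 2 * \<rho>" and r2: "2 \<le> jrank \<J>" using r by auto
      have "0 \<le> \<alpha>" by (simp add: \<alpha> log_ge1_def)
      then have \<rho>: "0 < \<rho>" using lt by simp
      note par = accuracy_parameters[OF r2 m \<Delta> \<epsilon> \<delta> \<beta> \<alpha>[folded \<rho>_def] \<rho> lt T_def]
      have \<eta>: "0 < \<eta>" "\<eta> \<le> 1 / 2" using par(1) \<rho> lt by (simp_all add: \<eta>_def field_simps)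
      define s where "s = \<epsilon>' / (2 * \<Delta>)"
      have s: "0 < s" using \<epsilon>'0 \<Delta> by (simp add: s_def)
      note ps' = supp[OF ps(1)]
      have idx: "ps ! k < m" if "k < T" for k using ps' that nth_mem by fastforce
      \<comment> \<open>Feasibility replaces \<open>b\<close> by the pairing with \<open>x\<close>,
        which turns scores into regret.\<close>
      have "\<eta> / \<rho> * (\<Sum>k<T. Q (take k ps) (ps ! k))
          \<le> \<eta> / \<rho> * (\<Sum>k<T. trace_inner \<J> (a (ps ! k)) (X (take k ps)) - trace_inner \<J> (a (ps ! k)) x)"
        using \<eta> \<rho> feas[OF idx] by (intro mult_left_mono sum_mono) (auto simp: Q_def)
      also have "\<dots> \<le> ln (real (jrank \<J>)) + 2 * \<eta>\<^sup>2 * real T"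
        using mw_regret[of ps a \<rho> \<eta> x] a norm ps' r \<rho> \<eta> x by (auto simp: X_def)
      finally have reg: "(\<Sum>k<T. Q (take k ps) (ps ! k))
          \<le> (ln (real (jrank \<J>)) + 2 * \<eta>\<^sup>2 * real T) * (\<rho> / \<eta>)"
        using \<eta> \<rho> by (simp add: field_simps)
      \<comment> \<open>The maximum dominates every constraint, so the single event \<open>B\<close>
        serves all of them without a union bound.\<close>
      have "(\<Sum>k<T. s * (Q (take k ps) i - Q (take k ps) (ps ! k)))
          \<le> (\<Sum>k<T. s * (Max (Q (take k ps) ` {..<m}) - Q (take k ps) (ps ! k)))"
        using s i by (intro sum_mono mult_left_mono diff_right_mono Max_ge) auto
      also have "\<dots> \<le> real T * ln (real m) + ln (1 / \<beta>)"
        using ps(2) False ps' by (simp add: B_def s_def not_less)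
      finally have "(\<Sum>k<T. Q (take k ps) i) - (\<Sum>k<T. Q (take k ps) (ps ! k))
          \<le> (real T * ln (real m) + ln (1 / \<beta>)) * (1 / s)"
        using s by (simp add: sum_subtractf field_simps flip: sum_distrib_left)
      with reg have "(\<Sum>k<T. Q (take k ps) i) \<le> (ln (real (jrank \<J>)) + 2 * \<eta>\<^sup>2 * real T) * (\<rho> / \<eta>)
          + (real T * ln (real m) + ln (1 / \<beta>)) * (1 / s)" by linarith
      then have "(\<Sum>k<T. Q (take k ps) i) / real T \<le> ((ln (real (jrank \<J>)) + 2 * \<eta>\<^sup>2 * real T) * (\<rho> / \<eta>)
          + (real T * ln (real m) + ln (1 / \<beta>)) * (1 / s)) / real T" by (rule divide_right_mono) simp
      also have "\<dots> = \<rho> / \<eta> * ln (real (jrank \<J>)) / real T + 2 * \<eta> * \<rho>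
          + (ln (real m) + ln (1 / \<beta>) / real T) * (1 / s)"
        using T \<eta> s by (simp add: field_simps power2_eq_square)
      also have "\<rho> / \<eta> = 4 * \<rho>\<^sup>2 / \<alpha>" by (simp add: \<eta>_def power2_eq_square)
      also have "2 * \<eta> * \<rho> = \<alpha> / 2" using \<rho> by (simp add: \<eta>_def)
      also have "1 / s = 2 * \<Delta> * sqrt (8 * real T * ln (1 / \<delta>)) / \<epsilon>"
        by (simp add: s_def \<epsilon>'_def D_def)
      also have "4 * \<rho>\<^sup>2 / \<alpha> * ln (real (jrank \<J>)) / real T + \<alpha> / 2
          + (ln (real m) + ln (1 / \<beta>) / real T) * (2 * \<Delta> * sqrt (8 * real T * ln (1 / \<delta>)) / \<epsilon>) \<le> \<alpha>"
        using par(2,3) by linarith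
      finally have "(\<Sum>k<T. Q (take k ps) i) / real T \<le> \<alpha>" .
      moreover have "(\<Sum>k<T. Q (take k ps) i) / real T = trace_inner \<J> (a i) (h ps) - b i"
        using T by (simp add: havg[OF ps(1) i] Q_def sum_subtractf diff_divide_distrib)
      ultimately show ?thesis by simp
    qed
  qed
  then have "1 - \<beta> \<le> measure_pmf.prob (transcript K T)
      (h -` {x \<in> cone_of_squares \<J>. \<forall>i<m. trace_inner \<J> (a i) x \<le> b i + \<alpha>})"
    using PB by (intro pmf_prob_complement_bound[where B = B]) auto
  then show ?thesis by (simp add: M)
qed

end

theorem theoremC5:
  shows "\<exists>acc. acc \<in> soft_O mw_params mw_accuracy_bound \<and>
    (\<forall>p\<in>mw_params. 0 < mw_accuracy_bound p \<longrightarrow> 0 < acc p) \<and>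
    (\<forall>(\<J> :: 'v::real_inner jordan) (m::nat) (a :: nat \<Rightarrow> 'v) (\<epsilon>::real) (\<delta>::real) (\<beta>::real) (\<Delta>::real).
       euclidean_jordan_algebra \<J> \<longrightarrow> 1 \<le> m \<longrightarrow> (\<forall>i<m. a i \<in> jcarrier \<J>) \<longrightarrow>
       0 < \<epsilon> \<longrightarrow> 0 < \<delta> \<longrightarrow> \<delta> < 1 \<longrightarrow> 0 < \<beta> \<longrightarrow> \<beta> < 1 \<longrightarrow> 0 < \<Delta> \<longrightarrow>
       (\<epsilon> \<le> 48 * ln (1 / \<delta>) \<longrightarrow>
          (\<forall>\<alpha>\<ge>0. low_sens_scalar_private (jcarrier \<J>) m \<Delta> \<epsilon> \<delta> (mw_mechanism \<J> m a \<epsilon> \<delta> \<Delta> \<alpha>))) \<and>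
       (\<forall>b :: nat \<Rightarrow> real.
          (\<exists>x\<in>cone_of_squares \<J>. jtrace \<J> x = 1 \<and> (\<forall>i<m. trace_inner \<J> (a i) x \<le> b i)) \<longrightarrow>
          (let \<alpha> = acc (jrank \<J>, m, width \<J> m a, \<Delta>, \<epsilon>, \<delta>, \<beta>)
           in measure_pmf.prob (mw_mechanism \<J> m a \<epsilon> \<delta> \<Delta> \<alpha> b)
                {x \<in> cone_of_squares \<J>. \<forall>i<m. trace_inner \<J> (a i) x \<le> b i + \<alpha>} \<ge> 1 - \<beta>)))"
proof (intro exI[of _ "\<lambda>p. 16 * mw_accuracy_bound p"] conjI allI impI)
  \<comment> \<open>A plain constant multiple of the bound is enough, hence the exponent 0 of the
    logarithmic factor.\<close>
  show "(\<lambda>p. 16 * mw_accuracy_bound p) \<in> soft_O mw_params mw_accuracy_bound"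
    unfolding soft_O_def by (intro CollectI exI[of _ 16] exI[of _ 0]) (simp add: abs_mult)
  show "\<forall>p\<in>mw_params. 0 < mw_accuracy_bound p \<longrightarrow> 0 < 16 * mw_accuracy_bound p" by simp
next
  fix \<J> :: "'v jordan" and m :: nat and a :: "nat \<Rightarrow> 'v" and \<epsilon> \<delta> \<beta> \<Delta> :: real and b :: "nat \<Rightarrow> real"
  assume "euclidean_jordan_algebra \<J>" and h: "1 \<le> m" "\<forall>i<m. a i \<in> jcarrier \<J>"
    "0 < \<epsilon>" "0 < \<delta>" "\<delta> < 1" "0 < \<beta>" "\<beta> < 1" "0 < \<Delta>"
    and feas: "\<exists>x\<in>cone_of_squares \<J>. jtrace \<J> x = 1 \<and> (\<forall>i<m. trace_inner \<J> (a i) x \<le> b i)"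
  then interpret euclidean_jordan_algebra \<J> by simp
  obtain x where "x \<in> cone_of_squares \<J>" "jtrace \<J> x = 1" "\<forall>i<m. trace_inner \<J> (a i) x \<le> b i"
    using feas by blast
  then show "let \<alpha> = 16 * mw_accuracy_bound (jrank \<J>, m, width \<J> m a, \<Delta>, \<epsilon>, \<delta>, \<beta>)
    in measure_pmf.prob (mw_mechanism \<J> m a \<epsilon> \<delta> \<Delta> \<alpha> b)
      {x \<in> cone_of_squares \<J>. \<forall>i<m. trace_inner \<J> (a i) x \<le> b i + \<alpha>} \<ge> 1 - \<beta>"
    unfolding Let_def using h by (intro mw_mechanism_accurate[OF _ _ _ _ _ _ _ _ _ _ _ refl]) auto
qed (rule mw_mechanism_private)

end
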